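(* Let $\psi$ be a Borel measurable function on the boundary $\partial\mathbb B$ of the unit ball $\mathbb B\subset\mathbb C^n$, whose restriction to some closed subset $F_0\subset\partial\mathbb B$ is continuous. Then there exist a holomorphic function $f$ on $\mathbb B$ and a set $F\subset\partial\mathbb B$, with $F_0\subset F$ and $\nu(\partial\mathbb B\setminus F)=0$, such that, for every $p\in F$, there is a set $\mathcal F_p\subset\mathbb B$ such that $$f(x)\to\psi(p)\quad\text{as}\quad x\to p,\ x\in\mathcal F_p,$$ and $$\lim_{r\searrow 0}\frac{m\big(\mathbb B(p,r)\cap\mathcal F_p\big)}{m\big(\mathbb B(p,r)\cap\mathbb B\big)}=1.$$
   Context: For $p\in\mathbb C^n$ and $r>0$, $\mathbb B(p,r)$ is the open Euclidean ball of center $p$ and radius $r$, and $\mathbb B=\mathbb B(0,1)$. $m$ is Lebesgue $2n$-dimensional measure on $\mathbb C^n=\mathbb R^{2n}$, and $\nu$ is the standard (rotation-invariant surface) measure on $\partial\mathbb B$ normalized to have total mass $1$. Functions are complex-valued. *)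

theory Defs
  imports "HOL-Analysis.Analysis"
begin

(* Holomorphy in several variables: real differentiable at every point, with a derivative
   that is complex linear (additivity of D is part of has_derivative). *)
definition holomorphic_on_cn :: "(complex ^ 'n \<Rightarrow> complex) \<Rightarrow> (complex ^ 'n) set \<Rightarrow> bool" where
  "holomorphic_on_cn f S \<longleftrightarrow>
     (\<forall>z\<in>S. \<exists>D. (f has_derivative D) (at z) \<and> (\<forall>c v. D (c *s v) = c * D v))"

(* Normalized surface measure on the unit sphere, via polar coordinates: the image of the
   uniform distribution on the unit ball, punctured at 0, under x \<mapsto> x / |x|.
   The lemma emeasure_sphere_measure gives the equivalent cone formula. *)
definition sphere_measure :: "'a::euclidean_space measure" where
  "sphere_measure =
     distr (restrict_space (uniform_measure lborel (ball 0 1)) (- {0}))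
           (restrict_space borel (sphere 0 1)) sgn"

lemma space_sphere_measure [simp]: "space sphere_measure = sphere 0 1"
  by (simp add: sphere_measure_def space_restrict_space)

lemma sets_sphere_measure [simp, measurable_cong]:
  "sets sphere_measure = sets (restrict_space borel (sphere 0 1))"
  by (simp add: sphere_measure_def)

lemma measurable_sgn_sphere:
  "sgn \<in> measurable (restrict_space borel (- {0}))
     (restrict_space borel (sphere (0::'a::euclidean_space) 1))"
proof (rule measurable_restrict_space2)
  show "sgn \<in> space (restrict_space borel (- {0})) \<rightarrow> sphere (0::'a) 1"
    by (auto simp: space_restrict_space norm_sgn)
  have "continuous_on (- {0}) (sgn :: 'a \<Rightarrow> 'a)"
    unfolding sgn_div_norm by (intro continuous_intros) auto
  then show "sgn \<in> borel_measurable (restrict_space borel (- {0::'a}))"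
    by (rule borel_measurable_continuous_on_restrict)
qed

lemma emeasure_sphere_measure:
  fixes A :: "'a::euclidean_space set"
  assumes "A \<in> sets borel" "A \<subseteq> sphere 0 1"
  shows "emeasure sphere_measure A =
    emeasure lborel {t *\<^sub>R x |t x. 0 < t \<and> t < 1 \<and> x \<in> A} / emeasure lborel (ball (0::'a) 1)"
proof -
  let ?U = "uniform_measure lborel (ball (0::'a) 1)"
  let ?C = "sgn -` A \<inter> - {0}"
  have A: "A \<in> sets (restrict_space borel (sphere (0::'a) 1))"
    using assms by (subst sets_restrict_space_iff) auto
  have sR: "sets (restrict_space ?U (- {0})) = sets (restrict_space borel (- {0::'a}))"
    by (intro sets_restrict_space_cong) simp
  have m: "sgn \<in> measurable (restrict_space ?U (- {0})) (restrict_space borel (sphere (0::'a) 1))"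
    using measurable_sgn_sphere measurable_cong_sets[OF sR refl] by blast
  have "?C \<in> sets (restrict_space borel (- {0::'a}))"
    using measurable_sets[OF measurable_sgn_sphere A] by (simp add: space_restrict_space)
  then have C: "?C \<in> sets borel"
    by (subst (asm) sets_restrict_space_iff) auto
  have "ball 0 1 \<inter> ?C = {t *\<^sub>R x |t x. 0 < t \<and> t < 1 \<and> x \<in> A}" (is "?L = ?R")
  proof (intro equalityI subsetI)
    fix y assume "y \<in> ?L"
    then have "y = norm y *\<^sub>R sgn y" "0 < norm y" "norm y < 1" "sgn y \<in> A"
      by (auto simp: sgn_div_norm)
    then show "y \<in> ?R" by blast
  next
    fix y assume "y \<in> ?R"
    then obtain t x where y: "y = t *\<^sub>R x" "0 < t" "t < 1" "x \<in> A" by blast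
    moreover have "norm x = 1" using y assms by auto
    ultimately show "y \<in> ?L" by (auto simp: sgn_div_norm)
  qed
  moreover have "emeasure sphere_measure A = emeasure ?U ?C"
    unfolding sphere_measure_def
    by (subst emeasure_distr[OF m A], subst emeasure_restrict_space)
       (auto simp: space_restrict_space)
  ultimately show ?thesis
    using C by simp
qed

lemma emeasure_sphere_measure_sphere:
  "emeasure sphere_measure (sphere (0::'a::euclidean_space) 1) = 1"
proof -
  have eq: "{t *\<^sub>R x |t x. 0 < t \<and> t < 1 \<and> x \<in> sphere (0::'a) 1} = ball 0 1 - {0}" (is "?L = ?R")
  proof (intro equalityI subsetI)
    fix y assume "y \<in> ?R"
    then have "y = norm y *\<^sub>R sgn y" "0 < norm y" "norm y < 1" "sgn y \<in> sphere 0 1"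
      by (auto simp: norm_sgn sgn_div_norm)
    then show "y \<in> ?L" by blast
  qed auto
  have "emeasure lborel (ball (0::'a) 1 - {0}) = emeasure lborel (ball (0::'a) 1)"
    by (intro emeasure_Diff_null_set) auto
  moreover have "emeasure lborel (ball (0::'a) 1) \<noteq> 0"
    using content_ball_pos[of 1 "0::'a"] by (auto simp: measure_def)
  moreover have "emeasure lborel (ball (0::'a) 1) \<noteq> \<infinity>"
    using emeasure_lborel_ball_finite[of "0::'a" 1] by auto
  ultimately show ?thesis
    using emeasure_sphere_measure[of "sphere (0::'a) 1"]
    unfolding eq by (simp add: ennreal_divide_self top.not_eq_extremum)
qed

end

theory Submission
  imports
    Defs
    "HOL-Complex_Analysis.Complex_Analysis"
    "HOL-Computational_Algebra.Fundamental_Theorem_Algebra"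
begin

text \<open>
  By Lusin's theorem and Tietze's extension theorem there are continuous functions \<open>g k\<close> on the
  sphere that converge to \<open>\<psi>\<close> at every point of \<open>F\<^sub>0\<close> and at almost every other point
  (\<open>continuous_approximation_on_sphere\<close>). It remains to find a holomorphic \<open>f\<close> that is close to
  \<open>g k\<close>, for larger and larger \<open>k\<close>, on most of the ball near the sphere
  (\<open>holomorphic_with_boundary_limits\<close>).

  The function \<open>f\<close> is the limit of bounded holomorphic functions \<open>f k\<close>, corrected successively
  near the sphere. For radii \<open>\<rho> k\<close> increasing to \<open>1\<close>, the shell \<open>\<rho> (k + 1) \<le> \<bar>z\<bar> < 1\<close> is covered by
  finitely many small caps of the ball that do not meet the ball of radius \<open>\<rho> k\<close>. Each cap is the
  part of the ball beyond a hyperplane \<open>z \<bullet> u = t\<close>, and \<open>z \<bullet> u\<close> is the real part of a complex linear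
  form \<open>l\<close>. Take a function \<open>h\<close> of one variable that is nearly \<open>0\<close> for \<open>Re w \<le> t - \<epsilon>\<close> and nearly
  \<open>1\<close> for \<open>Re w \<ge> t + \<epsilon>\<close>. Replacing \<open>q\<close> by \<open>q + (g k u - q) * (h \<circ> l)\<close> barely changes \<open>q\<close> below the
  hyperplane and gives nearly the constant \<open>g k u\<close> above it (\<open>cap_step\<close>). Since only half-spaces
  occur, this is one-variable approximation: \<open>h\<close> comes from rational functions with poles on the
  line \<open>Re w = t\<close>, which are pushed out of the disc along the removed strip
  (\<open>step_function_approximable\<close>). Treating all caps of a stage in turn gives \<open>shell_step\<close>.

  Exceptional points arise in two ways. The slabs \<open>\<bar>z \<bullet> u - t\<bar> < \<epsilon>\<close> of stage \<open>k\<close> matter only up to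
  radius \<open>\<rho> (k + 2)\<close>, because the caps of the next stage prescribe new values beyond it; and their
  width can be taken as small as one likes after everything else has been fixed. Secondly, for
  given \<open>p\<close>, the values of \<open>g k\<close> are near \<open>g k p\<close> only within some distance \<open>\<delta> k\<close> of \<open>p\<close>, and this
  excludes a part of the shell \<open>\<rho> k \<le> \<bar>z\<bar> < 1\<close> farther from \<open>p\<close> than about \<open>\<delta> k\<close>; that shell is
  tiny compared with \<open>\<delta> k\<close> if \<open>\<rho> k\<close> tends to \<open>1\<close> fast enough. Both kinds of sets have density \<open>0\<close> at
  every point \<open>p\<close> of the sphere (\<open>density_one_outside_union\<close>), and off them \<open>f\<close> has at \<open>p\<close> the same
  limit as \<open>g k p\<close>.
\<close>

section \<open>Approximating a step function on the cut unit disc\<close>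

text \<open>
  The uniform limits, on a subset \<open>K\<close> of the unit disc, of bounded holomorphic functions on the disc.
  They take the place of uniform limits of polynomials: on the open disc boundedness is all
  that the later products of such functions need.
\<close>
definition approximable :: "complex set \<Rightarrow> (complex \<Rightarrow> complex) set" where
  "approximable K = {g. \<forall>e>0. \<exists>h. h holomorphic_on ball 0 1 \<and> bounded (h ` ball 0 1) \<and>
     (\<forall>w\<in>K. norm (h w - g w) \<le> e)}"

lemma approximableI_holomorphic:
  assumes "h holomorphic_on ball 0 1" "bounded (h ` ball 0 1)"
  shows "h \<in> approximable K"
  using assms unfolding approximable_def by (auto intro!: exI[of _ h])

lemma approximable_const: "(\<lambda>w. c) \<in> approximable K"
  by (rule approximableI_holomorphic) (auto intro!: holomorphic_intros simp: image_constant_conv)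

lemma approximable_limit:
  assumes "\<And>e. 0 < e \<Longrightarrow> \<exists>g'\<in>approximable K. \<forall>w\<in>K. norm (g' w - g w) \<le> e"
  shows "g \<in> approximable K"
  unfolding approximable_def
proof (intro CollectI allI impI)
  fix e :: real assume e: "0 < e"
  obtain g' where g': "g' \<in> approximable K" "\<And>w. w \<in> K \<Longrightarrow> norm (g' w - g w) \<le> e/2"
    using assms[of "e/2"] e by auto
  obtain h where h: "h holomorphic_on ball 0 1" "bounded (h ` ball 0 1)"
      "\<And>w. w \<in> K \<Longrightarrow> norm (h w - g' w) \<le> e/2"
    using g'(1) e unfolding approximable_def by (auto dest!: spec[of _ "e/2"])
  have "norm (h w - g w) \<le> e" if "w \<in> K" for w
    using norm_triangle_ineq[of "h w - g' w" "g' w - g w"] g'(2)[OF that] h(3)[OF that] by simp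
  with h show "\<exists>h. h holomorphic_on ball 0 1 \<and> bounded (h ` ball 0 1) \<and> (\<forall>w\<in>K. norm (h w - g w) \<le> e)"
    by blast
qed

lemma approximable_cong:
  assumes "g \<in> approximable K" "\<And>w. w \<in> K \<Longrightarrow> g w = g' w"
  shows "g' \<in> approximable K"
  using assms by (intro approximable_limit) (auto intro!: bexI[of _ g])

lemma approximable_bounded:
  assumes "g \<in> approximable K" "K \<subseteq> ball 0 1"
  obtains B where "0 < B" "\<And>w. w \<in> K \<Longrightarrow> norm (g w) \<le> B"
proof -
  obtain h where h: "bounded (h ` ball 0 1)" "\<And>w. w \<in> K \<Longrightarrow> norm (h w - g w) \<le> 1"
    using assms(1) unfolding approximable_def by (auto dest!: spec[of _ 1])
  obtain C where C: "0 < C" "\<And>w. w \<in> ball 0 1 \<Longrightarrow> norm (h w) \<le> C"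
    using h(1) unfolding bounded_pos by (auto simp del: mem_ball_0)
  have "norm (g w) \<le> C + 1" if "w \<in> K" for w
    using norm_triangle_ineq4[of "h w" "h w - g w"] h(2)[OF that] C(2)[of w] that assms(2) by auto
  then show ?thesis using that[of "C + 1"] C by auto
qed

lemma bounded_image_add:
  fixes f g :: "'a \<Rightarrow> 'b::real_normed_vector"
  assumes "bounded (f ` S)" "bounded (g ` S)"
  shows "bounded ((\<lambda>x. f x + g x) ` S)"
proof -
  obtain B C where "\<forall>x\<in>S. norm (f x) \<le> B" "\<forall>x\<in>S. norm (g x) \<le> C"
    using assms unfolding bounded_iff by auto
  then have "\<forall>x\<in>S. norm (f x + g x) \<le> B + C"
    by (meson add_mono norm_triangle_le)
  then show ?thesis unfolding bounded_iff by auto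
qed

lemma bounded_image_mult:
  fixes f g :: "'a \<Rightarrow> 'b::real_normed_algebra"
  assumes "bounded (f ` S)" "bounded (g ` S)"
  shows "bounded ((\<lambda>x. f x * g x) ` S)"
proof -
  obtain B C where "\<forall>x\<in>S. norm (f x) \<le> B" "\<forall>x\<in>S. norm (g x) \<le> C" 
    using assms unfolding bounded_iff by auto
  then have "\<forall>x\<in>S. norm (f x * g x) \<le> B * C"
    by (meson mult_mono norm_ge_zero norm_mult_ineq order_trans)
  then show ?thesis unfolding bounded_iff by auto
qed

lemma approximable_add:
  assumes "f \<in> approximable K" "g \<in> approximable K"
  shows "(\<lambda>w. f w + g w) \<in> approximable K"
  unfolding approximable_def
proof (intro CollectI allI impI)
  fix e :: real assume e: "0 < e"
  obtain h where h: "h holomorphic_on ball 0 1" "bounded (h ` ball 0 1)"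
      "\<And>w. w \<in> K \<Longrightarrow> norm (h w - f w) \<le> e/2"
    using assms(1) e unfolding approximable_def by (auto dest!: spec[of _ "e/2"])
  obtain k where k: "k holomorphic_on ball 0 1" "bounded (k ` ball 0 1)"
      "\<And>w. w \<in> K \<Longrightarrow> norm (k w - g w) \<le> e/2"
    using assms(2) e unfolding approximable_def by (auto dest!: spec[of _ "e/2"])
  have "norm ((h w + k w) - (f w + g w)) \<le> e" if "w \<in> K" for w
    using norm_triangle_ineq[of "h w - f w" "k w - g w"] h(3)[OF that] k(3)[OF that]
    by (simp add: algebra_simps)
  moreover have "(\<lambda>w. h w + k w) holomorphic_on ball 0 1" using h k by (intro holomorphic_intros)
  ultimately show "\<exists>h. h holomorphic_on ball 0 1 \<and> bounded (h ` ball 0 1) \<and>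
      (\<forall>w\<in>K. norm (h w - (f w + g w)) \<le> e)"
    using bounded_image_add[OF h(2) k(2)] by blast
qed

lemma approximable_mult:
  assumes f: "f \<in> approximable K" and g: "g \<in> approximable K" and K: "K \<subseteq> ball 0 1"
  shows "(\<lambda>w. f w * g w) \<in> approximable K"
  unfolding approximable_def
proof (intro CollectI allI impI)
  fix e :: real assume e: "0 < e"
  obtain B where B: "0 < B" "\<And>w. w \<in> K \<Longrightarrow> norm (f w) \<le> B" using approximable_bounded[OF f K] by blast
  obtain C where C: "0 < C" "\<And>w. w \<in> K \<Longrightarrow> norm (g w) \<le> C" using approximable_bounded[OF g K] by blast
  define d where "d = min 1 (e / (B + C + 1))"
  have d: "0 < d" "d \<le> 1" "d * (B + C + 1) \<le> e"
  proof -
    show "0 < d" "d \<le> 1" using B(1) C(1) e by (auto simp: d_def)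
    have "d \<le> e / (B + C + 1)" by (simp add: d_def)
    then show "d * (B + C + 1) \<le> e" using B(1) C(1) by (simp add: pos_le_divide_eq)
  qed
  obtain h where h: "h holomorphic_on ball 0 1" "bounded (h ` ball 0 1)"
      "\<And>w. w \<in> K \<Longrightarrow> norm (h w - f w) \<le> d"
    using f d unfolding approximable_def by (auto dest!: spec[of _ d])
  obtain k where k: "k holomorphic_on ball 0 1" "bounded (k ` ball 0 1)"
      "\<And>w. w \<in> K \<Longrightarrow> norm (k w - g w) \<le> d"
    using g d unfolding approximable_def by (auto dest!: spec[of _ d])
  have "norm (h w * k w - f w * g w) \<le> e" if "w \<in> K" for w
  proof -
    have "h w * k w - f w * g w = (h w - f w) * (k w - g w) + (h w - f w) * g w + f w * (k w - g w)"
      by (simp add: algebra_simps)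
    also have "norm \<dots> \<le> norm (h w - f w) * norm (k w - g w) + norm (h w - f w) * norm (g w) + norm (f w) * norm (k w - g w)"
      by (intro order_trans[OF norm_triangle_ineq] add_mono) (auto simp: norm_mult)
    also have "\<dots> \<le> d * 1 + d * C + B * d"
      using h(3)[OF that] k(3)[OF that] B(2)[OF that] C(2)[OF that] d B(1) C(1)
      by (intro add_mono mult_mono) auto
    also have "\<dots> \<le> e" using d(3) by (simp add: algebra_simps)
    finally show ?thesis .
  qed
  moreover have "(\<lambda>w. h w * k w) holomorphic_on ball 0 1" using h k by (intro holomorphic_intros)
  ultimately show "\<exists>h. h holomorphic_on ball 0 1 \<and> bounded (h ` ball 0 1) \<and>
      (\<forall>w\<in>K. norm (h w - (f w * g w)) \<le> e)"
    using bounded_image_mult[OF h(2) k(2)] by blast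
qed

lemma approximable_power:
  assumes "f \<in> approximable K" "K \<subseteq> ball 0 1"
  shows "(\<lambda>w. f w ^ n) \<in> approximable K"
proof (induction n)
  case 0
  show ?case by (simp add: approximable_const)
next
  case (Suc n)
  then show ?case using approximable_mult[OF assms(1) _ assms(2)] by simp
qed

lemma approximable_sum:
  fixes n :: nat
  assumes "\<And>i. i < n \<Longrightarrow> f i \<in> approximable K"
  shows "(\<lambda>w. \<Sum>i<n. f i w) \<in> approximable K"
  using assms
proof (induction n)
  case 0
  show ?case by (simp add: approximable_const)
next
  case (Suc n)
  then show ?case
    using approximable_add[of "\<lambda>w. \<Sum>i<n. f i w" K "f n"] by simp
qed

text \<open>
  The open unit disc without the vertical strip of half-width \<open>\<epsilon>\<close> around \<open>Re w = t\<close>.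
\<close>
definition slit_disc :: "real \<Rightarrow> real \<Rightarrow> complex set" where
  "slit_disc t \<epsilon> = {w \<in> ball 0 1. \<epsilon> \<le> \<bar>Re w - t\<bar>}"

lemma slit_disc_subset: "slit_disc t \<epsilon> \<subseteq> ball 0 1"
  by (auto simp: slit_disc_def)

lemma approximable_pole_far:
  assumes "2 \<le> norm s"
  shows "(\<lambda>w. 1 / (w - s)) \<in> approximable K"
proof (rule approximableI_holomorphic)
  have far: "1 \<le> norm (w - s)" if "w \<in> ball 0 1" for w
    using norm_triangle_ineq2[of s w] that assms by (simp add: norm_minus_commute)
  then have "w - s \<noteq> 0" if "w \<in> ball 0 1" for w using that by fastforce
  then show "(\<lambda>w. 1 / (w - s)) holomorphic_on ball 0 1"
    by (intro holomorphic_intros) auto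
  show "bounded ((\<lambda>w. 1 / (w - s)) ` ball 0 1)"
    unfolding bounded_iff using far
    by (intro exI[of _ 1]) (auto simp: norm_divide divide_le_eq_1)
qed

text \<open>
  Pole pushing: a pole may be moved by at most half of its distance to \<open>K\<close>, because the
  geometric series in \<open>(s' - s) / (w - s)\<close> then converges uniformly on \<open>K\<close>.
\<close>
lemma approximable_pole_shift:
  assumes s: "(\<lambda>w. 1 / (w - s)) \<in> approximable K" and K: "K \<subseteq> ball 0 1" and "0 < \<epsilon>"
    and dist: "\<And>w. w \<in> K \<Longrightarrow> \<epsilon> \<le> norm (w - s)" and near: "norm (s' - s) \<le> \<epsilon> / 2"
  shows "(\<lambda>w. 1 / (w - s')) \<in> approximable K"
proof (rule approximable_limit)
  fix e :: real assume e: "0 < e"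
  obtain n where n: "(1/2::real) ^ n < e * \<epsilon> / 2"
    using real_arch_pow_inv[of "e * \<epsilon> / 2" "1/2"] e \<open>0 < \<epsilon>\<close> by auto
  let ?g = "\<lambda>w. \<Sum>i<n. (s' - s) ^ i * (1 / (w - s)) ^ Suc i"
  have "?g \<in> approximable K"
    by (rule approximable_sum)
      (rule approximable_mult[OF approximable_const approximable_power[OF s K] K])
  moreover have "norm (?g w - 1 / (w - s')) \<le> e" if "w \<in> K" for w
  proof -
    define x where "x = (s' - s) / (w - s)"
    have ws: "\<epsilon> \<le> norm (w - s)" using dist that by auto
    then have nz: "w - s \<noteq> 0" using \<open>0 < \<epsilon>\<close> by auto
    have ws': "\<epsilon> / 2 \<le> norm (w - s')"
      using norm_triangle_ineq2[of "w - s" "s' - s"] ws near by (simp add: algebra_simps)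
    then have nz': "w - s' \<noteq> 0" using \<open>0 < \<epsilon>\<close> by auto
    have "norm x \<le> 1 / 2"
      using ws near \<open>0 < \<epsilon>\<close> unfolding x_def norm_divide
      by (simp add: divide_le_eq)
    then have x1: "x \<noteq> 1" and xn: "norm (x ^ n) \<le> (1/2) ^ n"
      by (auto simp: norm_power intro: power_mono)
    have "?g w = (\<Sum>i<n. x ^ i) / (w - s)"
      by (simp add: x_def power_divide sum_divide_distrib mult_ac)
    also have "\<dots> = ((1 - x ^ n) / (1 - x)) / (w - s)"
      using x1 by (simp add: sum_gp_strict)
    also have "(1 - x) * (w - s) = w - s'" using nz by (simp add: x_def field_simps)
    then have "((1 - x ^ n) / (1 - x)) / (w - s) = (1 - x ^ n) / (w - s')" by simp
    finally have "?g w - 1 / (w - s') = - (x ^ n) / (w - s')"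
      by (simp add: diff_divide_distrib)
    then have "norm (?g w - 1 / (w - s')) = norm (x ^ n) / norm (w - s')" by (simp add: norm_divide)
    also have "\<dots> \<le> (1/2) ^ n / (\<epsilon> / 2)"
      using xn ws' \<open>0 < \<epsilon>\<close> by (intro frac_le) auto
    also have "\<dots> \<le> e" using n \<open>0 < \<epsilon>\<close> by (simp add: field_simps)
    finally show ?thesis .
  qed
  ultimately show "\<exists>g'\<in>approximable K. \<forall>w\<in>K. norm (g' w - 1 / (w - s')) \<le> e"
    by (intro bexI[of _ ?g]) auto
qed

text \<open>
  A pole on the line \<open>Re w = t\<close> is pushed there along the removed strip, starting outside the disc.
\<close>
lemma approximable_pole:
  assumes \<epsilon>: "0 < \<epsilon>" and s: "Re s = t"
  shows "(\<lambda>w. 1 / (w - s)) \<in> approximable (slit_disc t \<epsilon>)"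
proof -
  \<comment> \<open>The poles at height at least 2 are harmless; each step of the induction descends by \<open>\<epsilon> / 2\<close>.\<close>
  have *: "\<forall>y\<ge>2 - real m * (\<epsilon> / 2). (\<lambda>w. 1 / (w - Complex t y)) \<in> approximable (slit_disc t \<epsilon>)" for m
  proof (induction m)
    case 0
    show ?case
    proof (intro allI impI approximable_pole_far)
      fix y :: real assume "2 - real 0 * (\<epsilon> / 2) \<le> y"
      then show "2 \<le> norm (Complex t y)" using abs_Im_le_cmod[of "Complex t y"] by simp
    qed
  next
    case (Suc m)
    show ?case
    proof (intro allI impI)
      fix y :: real assume y: "2 - real (Suc m) * (\<epsilon> / 2) \<le> y"
      have "(\<lambda>w. 1 / (w - Complex t (y + \<epsilon> / 2))) \<in> approximable (slit_disc t \<epsilon>)"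
        using Suc y by (auto simp: algebra_simps add_divide_distrib)
      moreover have "\<epsilon> \<le> norm (w - Complex t (y + \<epsilon> / 2))" if "w \<in> slit_disc t \<epsilon>" for w
        using that abs_Re_le_cmod[of "w - Complex t (y + \<epsilon> / 2)"] by (auto simp: slit_disc_def)
      moreover have "norm (Complex t y - Complex t (y + \<epsilon> / 2)) \<le> \<epsilon> / 2"
        using \<epsilon> by (simp add: cmod_def)
      ultimately show "(\<lambda>w. 1 / (w - Complex t y)) \<in> approximable (slit_disc t \<epsilon>)"
        by (rule approximable_pole_shift[OF _ slit_disc_subset \<epsilon>])
    qed
  qed
  obtain m where "(2 - Im s) / (\<epsilon> / 2) \<le> real m" using real_arch_simple by blast
  then have "2 - real m * (\<epsilon> / 2) \<le> Im s" using \<epsilon> by (simp add: field_simps)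
  with *[of m] s show ?thesis by (metis complex.collapse)
qed

lemma approximable_inverse_poly:
  assumes \<epsilon>: "0 < \<epsilon>" and "p \<noteq> 0" and "\<And>s. poly p s = 0 \<Longrightarrow> Re s = t"
  shows "(\<lambda>w. 1 / poly p w) \<in> approximable (slit_disc t \<epsilon>)"
  using assms(2,3)
proof (induction "degree p" arbitrary: p)
  case 0
  then obtain c where "p = [:c:]" using degree_eq_zeroE by metis
  then show ?case by (simp add: approximable_const)
next
  case (Suc n)
  then have "\<not> (\<exists>a l. a \<noteq> 0 \<and> l = 0 \<and> p = pCons a l)" by auto
  then obtain s where s: "poly p s = 0" using fundamental_theorem_of_algebra_alt by blast
  then obtain q where q: "p = [:- s, 1:] * q" by (metis dvdE poly_eq_0_iff_dvd)
  have "q \<noteq> 0" using q Suc.prems by auto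
  then have "degree p = Suc (degree q)" unfolding q by (subst degree_mult_eq) auto
  then have "(\<lambda>w. 1 / poly q w) \<in> approximable (slit_disc t \<epsilon>)"
    using Suc.hyps Suc.prems(2) \<open>q \<noteq> 0\<close> by (intro Suc.hyps(1)) (auto simp: q)
  moreover have "(\<lambda>w. 1 / (w - s)) \<in> approximable (slit_disc t \<epsilon>)"
    using \<epsilon> Suc.prems(2) s by (intro approximable_pole) auto
  ultimately have "(\<lambda>w. (1 / poly q w) * (1 / (w - s))) \<in> approximable (slit_disc t \<epsilon>)"
    by (rule approximable_mult[OF _ _ slit_disc_subset])
  moreover have "1 / poly q w * (1 / (w - s)) = 1 / poly p w" for w
    by (simp add: q divide_simps) (simp add: algebra_simps)
  ultimately show ?case by simp
qed

lemma approximable_poly: "poly p \<in> approximable K"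
proof (rule approximableI_holomorphic)
  show "poly p holomorphic_on ball 0 1" by (intro holomorphic_intros)
  have "compact (poly p ` cball 0 1)" by (intro compact_continuous_image continuous_intros) auto
  then show "bounded (poly p ` ball 0 1)"
    by (rule bounded_subset[OF compact_imp_bounded]) auto
qed

lemma norm_one_minus_vs_plus:
  fixes v :: complex
  shows "norm (1 + v) ^ 2 - norm (1 - v) ^ 2 = 4 * Re v"
  unfolding cmod_power2 by (simp add: power2_eq_square algebra_simps)

lemma power_quotient_small:
  fixes v :: complex
  assumes v: "norm v \<le> 2" "\<epsilon> \<le> Re v" and \<epsilon>: "0 < \<epsilon>" "\<epsilon> \<le> 1"
  shows "norm (((1 - v) / (1 + v)) ^ (2 * n)) \<le> (1 - 4 * \<epsilon> / 9) ^ n" and "1 + v \<noteq> 0"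
proof -
  have "0 < Re (1 + v)" using v \<epsilon> by simp
  then show nz: "1 + v \<noteq> 0" by (metis less_irrefl zero_complex.simps(1))
  have le: "norm (1 + v) \<le> 3" using norm_triangle_ineq[of 1 v] v by simp
  have "norm (1 + v) ^ 2 \<le> 3 ^ 2" using le by (intro power_mono) auto
  then have "(4 * \<epsilon> / 9) * norm (1 + v) ^ 2 \<le> 4 * \<epsilon>" using \<epsilon> by simp
  then have "norm (1 - v) ^ 2 \<le> (1 - 4 * \<epsilon> / 9) * norm (1 + v) ^ 2"
    using norm_one_minus_vs_plus[of v] v by (simp add: algebra_simps)
  then have "norm ((1 - v) / (1 + v)) ^ 2 \<le> 1 - 4 * \<epsilon> / 9"
    using nz by (simp add: norm_divide power_divide divide_le_eq)
  then have "(norm ((1 - v) / (1 + v)) ^ 2) ^ n \<le> (1 - 4 * \<epsilon> / 9) ^ n"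
    by (intro power_mono) auto
  then show "norm (((1 - v) / (1 + v)) ^ (2 * n)) \<le> (1 - 4 * \<epsilon> / 9) ^ n"
    by (simp add: norm_power power_mult)
qed

lemma norm_inverse_one_plus_small:
  fixes x :: complex
  assumes "norm x \<le> e" "e \<le> 1/2"
  shows "norm (1 / (1 + x) - 1) \<le> 2 * e" "1 + x \<noteq> 0"
proof -
  have ge: "1/2 \<le> norm (1 + x)" using norm_triangle_ineq2[of 1 "- x"] assms by simp
  then show nz: "1 + x \<noteq> 0" by auto
  have "1 / (1 + x) - 1 = - x / (1 + x)" using nz by (simp add: field_simps)
  then have "norm (1 / (1 + x) - 1) = norm x / norm (1 + x)" by (simp add: norm_divide)
  also have "\<dots> \<le> e / (1/2)"
    using assms ge order_trans[OF norm_ge_zero assms(1)] by (intro frac_le) auto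
  finally show "norm (1 / (1 + x) - 1) \<le> 2 * e" by simp
qed

text \<open>
  With \<open>v = w - t\<close>, the rational functions \<open>(1 + v) ^ (2n) / ((1 + v) ^ (2n) + (1 - v) ^ (2n))\<close>
  tend to \<open>1\<close> where \<open>Re v \<ge> \<epsilon>\<close> and to \<open>0\<close> where \<open>Re v \<le> - \<epsilon>\<close>, since
  \<open>\<bar>1 + v\<bar>\<^sup>2 - \<bar>1 - v\<bar>\<^sup>2 = 4 Re v\<close>; for the same reason all their poles lie on \<open>Re v = 0\<close>.
\<close>
lemma step_function_approximable:
  assumes t: "0 \<le> t" "t \<le> 1" and \<epsilon>: "0 < \<epsilon>"
  shows "(\<lambda>w. if t < Re w then 1 else 0) \<in> approximable (slit_disc t \<epsilon>)"
proof (cases "\<epsilon> \<le> 1")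
  case True
  show ?thesis
  proof (rule approximable_limit)
    fix e :: real assume e: "0 < e"
    define d where "d = min (1/2) (e/2)"
    have d: "0 < d" "d \<le> 1/2" "2 * d \<le> e" using e by (auto simp: d_def)
    have "1 - 4 * \<epsilon> / 9 < 1" "0 < d" using \<epsilon> d by auto
    then obtain n where n: "(1 - 4 * \<epsilon> / 9) ^ n < d"
      using real_arch_pow_inv by blast
    define q where "q = [:1 - complex_of_real t, 1:] ^ (2*n)"
    define p where "p = q + [:1 + complex_of_real t, - 1:] ^ (2*n)"
    have pq: "poly q w = (1 + (w - t)) ^ (2*n)"
        "poly p w = (1 + (w - t)) ^ (2*n) + (1 - (w - t)) ^ (2*n)" for w
      by (simp_all add: p_def q_def algebra_simps)
    have n0: "n \<noteq> 0" using n d by (intro notI) auto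
    have "poly p (1 + t) = 2 ^ (2*n)" unfolding pq using n0 by simp
    then have "p \<noteq> 0" by auto
    have roots: "Re s = t" if "poly p s = 0" for s
    proof -
      have "(1 + (s - t)) ^ (2*n) = - ((1 - (s - t)) ^ (2*n))"
        using that unfolding pq by (simp add: eq_neg_iff_add_eq_0)
      then have "norm (1 + (s - t)) ^ (2*n) = norm (1 - (s - t)) ^ (2*n)"
        by (metis norm_minus_cancel norm_power)
      then have "norm (1 + (s - t)) = norm (1 - (s - t))"
        using n0 by (simp add: power_eq_iff_eq_base)
      then show ?thesis using norm_one_minus_vs_plus[of "s - t"] by simp
    qed
    have "(\<lambda>w. 1 / poly p w) \<in> approximable (slit_disc t \<epsilon>)"
      by (rule approximable_inverse_poly[OF \<epsilon> \<open>p \<noteq> 0\<close> roots])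
    then have A: "(\<lambda>w. poly q w * (1 / poly p w)) \<in> approximable (slit_disc t \<epsilon>)"
      by (rule approximable_mult[OF approximable_poly _ slit_disc_subset])
    have "norm (poly q w * (1 / poly p w) - (if t < Re w then 1 else 0)) \<le> e"
      if w: "w \<in> slit_disc t \<epsilon>" for w
    proof -
      define v where "v = w - t"
      have "norm w < 1" using w by (simp add: slit_disc_def)
      then have v2: "norm v \<le> 2" using norm_triangle_ineq4[of w "complex_of_real t"] t by (simp add: v_def)
      have pq': "poly q w = (1 + v) ^ (2*n)" "poly p w = (1 + v) ^ (2*n) + (1 - v) ^ (2*n)"
        by (simp_all add: pq v_def)
      consider "\<epsilon> \<le> Re v" | "\<epsilon> \<le> Re (- v)" using w by (force simp: slit_disc_def v_def)
      then show ?thesis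
      proof cases
        case 1
        define x where "x = ((1 - v) / (1 + v)) ^ (2*n)"
        have x: "norm x \<le> d" and nz: "1 + v \<noteq> 0"
          using power_quotient_small(1)[OF v2 1 \<epsilon> True, of n]
            power_quotient_small(2)[OF v2 1 \<epsilon> True] n by (auto simp: x_def)
        have "poly q w * (1 / poly p w) = 1 / (1 + x)"
        proof -
          have "poly p w = (1 + v) ^ (2*n) * (1 + x)"
            using nz unfolding pq' x_def by (simp add: power_divide ring_distribs)
          then show ?thesis using nz unfolding pq' by simp
        qed
        moreover have "t < Re w" using 1 \<epsilon> by (simp add: v_def)
        ultimately show ?thesis
          using norm_inverse_one_plus_small(1)[OF x d(2)] d(3) by simp
      next
        case 2
        define x where "x = ((1 - (- v)) / (1 + (- v))) ^ (2*n)"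
        have x: "norm x \<le> d" and nz: "1 + (- v) \<noteq> 0"
          using power_quotient_small(1)[of "- v" \<epsilon> n, OF _ 2 \<epsilon> True]
            power_quotient_small(2)[of "- v" \<epsilon>, OF _ 2 \<epsilon> True] v2 n by (auto simp: x_def)
        have "poly q w * (1 / poly p w) = 1 - 1 / (1 + x)"
        proof -
          have p: "poly p w = (1 - v) ^ (2*n) * (1 + x)"
            using nz unfolding pq' x_def by (simp add: power_divide ring_distribs)
          have q: "poly q w = (1 - v) ^ (2*n) * x"
            using nz unfolding pq' x_def by (simp add: power_divide)
          have "poly q w * (1 / poly p w) = x / (1 + x)" using nz unfolding p q by simp
          also have "\<dots> = 1 - 1 / (1 + x)"
            using norm_inverse_one_plus_small(2)[OF x d(2)] by (simp add: divide_simps)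
          finally show ?thesis .
        qed
        moreover have "\<not> t < Re w" using 2 \<epsilon> by (simp add: v_def)
        ultimately show ?thesis
          using norm_inverse_one_plus_small(1)[OF x d(2)] d(3) by (simp add: norm_minus_commute)
      qed
    qed
    then show "\<exists>g'\<in>approximable (slit_disc t \<epsilon>). \<forall>w\<in>slit_disc t \<epsilon>.
        norm (g' w - (if t < Re w then 1 else 0)) \<le> e"
      by (intro bexI[of _ "\<lambda>w. poly q w * (1 / poly p w)"] A) simp
  qed
next
  case False
  have "(if t < Re w then 1 else 0) = (0::complex)" if "w \<in> slit_disc t \<epsilon>" for w
  proof -
    have "\<bar>Re w\<bar> < 1" using that abs_Re_le_cmod[of w] by (simp add: slit_disc_def)
    then show ?thesis using that False t by (auto simp: slit_disc_def)
  qed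
  then show ?thesis by (intro approximable_cong[OF approximable_const[of 0]]) auto
qed

section \<open>Holomorphic functions in several complex variables and half-spaces\<close>

text \<open>
  The Hermitian product with \<open>u\<close>, linear in \<open>z\<close>. Its real part is the Euclidean inner product,
  so real half-spaces are preimages of half-planes under a complex linear form.
\<close>
definition hform :: "complex ^ 'n \<Rightarrow> complex ^ 'n \<Rightarrow> complex" where
  "hform u z = (\<Sum>i\<in>UNIV. z $ i * cnj (u $ i))"

lemma Re_hform: "Re (hform u z) = z \<bullet> u"
  by (simp add: hform_def inner_vec_def inner_complex_def)

lemma hform_scale: "hform u (c *s z) = c * hform u z"
  by (simp add: hform_def sum_distrib_left mult.assoc)

lemma norm_vector_scalar_mult: "norm (c *s (z :: complex ^ 'n)) = norm c * norm z"
  by (simp add: norm_vec_def norm_mult L2_set_right_distrib)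

lemma norm_hform_le: "norm (hform u z) \<le> norm z * norm u"
proof (cases "hform u z = 0")
  case False
  \<comment> \<open>Rotate \<open>z\<close> so that the form becomes real, then use the real Cauchy-Schwarz inequality.\<close>
  define c where "c = cnj (hform u z) / norm (hform u z)"
  have c: "norm c = 1" using False by (simp add: c_def norm_divide)
  have "hform u (c *s z) = of_real (norm (hform u z))"
    using False unfolding hform_scale c_def
    by (simp add: complex_norm_square[symmetric] power2_eq_square mult.commute
        del: of_real_mult flip: of_real_mult) simp
  then have "norm (hform u z) = (c *s z) \<bullet> u" using Re_hform[of u "c *s z"] by simp
  also have "\<dots> \<le> norm (c *s z) * norm u" by (rule norm_cauchy_schwarz)
  finally show ?thesis by (simp add: norm_vector_scalar_mult c)
qed auto

lemma bounded_linear_hform: "bounded_linear (hform u)"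
proof (rule bounded_linear_intro)
  show "norm (hform u x) \<le> norm x * norm u" for x by (rule norm_hform_le)
qed (auto simp: hform_def sum.distrib ring_distribs scaleR_sum_right)

lemma holomorphic_on_cn_const: "holomorphic_on_cn (\<lambda>z. c) S"
  unfolding holomorphic_on_cn_def by (intro ballI exI[of _ "\<lambda>v. 0"]) auto

lemma holomorphic_on_cn_add:
  assumes "holomorphic_on_cn f S" "holomorphic_on_cn g S"
  shows "holomorphic_on_cn (\<lambda>z. f z + g z) S"
  unfolding holomorphic_on_cn_def
proof
  fix z assume z: "z \<in> S"
  obtain D E where D: "(f has_derivative D) (at z)" "\<And>c v. D (c *s v) = c * D v"
      and E: "(g has_derivative E) (at z)" "\<And>c v. E (c *s v) = c * E v"
    using assms z unfolding holomorphic_on_cn_def by meson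
  show "\<exists>D. ((\<lambda>z. f z + g z) has_derivative D) (at z) \<and> (\<forall>c v. D (c *s v) = c * D v)"
    by (rule exI[of _ "\<lambda>v. D v + E v"])
      (auto intro!: has_derivative_add D E simp: D(2) E(2) ring_distribs)
qed

lemma holomorphic_on_cn_mult:
  assumes "holomorphic_on_cn f S" "holomorphic_on_cn g S"
  shows "holomorphic_on_cn (\<lambda>z. f z * g z) S"
  unfolding holomorphic_on_cn_def
proof
  fix z assume z: "z \<in> S"
  obtain D E where D: "(f has_derivative D) (at z)" "\<And>c v. D (c *s v) = c * D v"
      and E: "(g has_derivative E) (at z)" "\<And>c v. E (c *s v) = c * E v"
    using assms z unfolding holomorphic_on_cn_def by meson
  show "\<exists>D. ((\<lambda>z. f z * g z) has_derivative D) (at z) \<and> (\<forall>c v. D (c *s v) = c * D v)"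
    by (rule exI[of _ "\<lambda>v. f z * E v + D v * g z"])
      (auto intro!: has_derivative_mult D E simp: D(2) E(2) ring_distribs)
qed

lemma holomorphic_on_cn_diff:
  assumes "holomorphic_on_cn f S" "holomorphic_on_cn g S"
  shows "holomorphic_on_cn (\<lambda>z. f z - g z) S"
  using holomorphic_on_cn_add[OF assms(1)
      holomorphic_on_cn_mult[OF holomorphic_on_cn_const[of "-1"] assms(2)]] by simp

lemma holomorphic_on_cn_compose_hform:
  assumes "h holomorphic_on T" "open T" "hform u ` S \<subseteq> T"
  shows "holomorphic_on_cn (\<lambda>z. h (hform u z)) S"
  unfolding holomorphic_on_cn_def
proof
  fix z assume z: "z \<in> S"
  have "(h has_field_derivative deriv h (hform u z)) (at (hform u z))"
    using assms z by (intro holomorphic_derivI[of h T]) auto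
  then have "(h has_derivative (*) (deriv h (hform u z))) (at (hform u z))"
    by (simp add: has_field_derivative_def)
  then have "((\<lambda>z. h (hform u z)) has_derivative (\<lambda>v. deriv h (hform u z) * hform u v)) (at z)"
    by (rule has_derivative_compose[OF bounded_linear.has_derivative[OF bounded_linear_hform has_derivative_ident]])
  then show "\<exists>D. ((\<lambda>z. h (hform u z)) has_derivative D) (at z) \<and> (\<forall>c v. D (c *s v) = c * D v)"
    by (intro exI[of _ "\<lambda>v. deriv h (hform u z) * hform u v"]) (auto simp: hform_scale)
qed

text \<open>Bounded holomorphic functions on the unit ball.\<close>
definition bounded_holo :: "(complex ^ 'n \<Rightarrow> complex) \<Rightarrow> bool" where
  "bounded_holo f \<longleftrightarrow> holomorphic_on_cn f (ball 0 1) \<and> bounded (f ` ball 0 1)"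

lemma bounded_holo_const: "bounded_holo (\<lambda>z. c)"
  by (auto simp: bounded_holo_def holomorphic_on_cn_const image_constant_conv)

lemma bounded_holo_add: "bounded_holo f \<Longrightarrow> bounded_holo g \<Longrightarrow> bounded_holo (\<lambda>z. f z + g z)"
  by (simp add: bounded_holo_def holomorphic_on_cn_add bounded_image_add)

lemma bounded_holo_mult: "bounded_holo f \<Longrightarrow> bounded_holo g \<Longrightarrow> bounded_holo (\<lambda>z. f z * g z)"
  by (simp add: bounded_holo_def holomorphic_on_cn_mult bounded_image_mult)

text \<open>
  A bounded holomorphic function can be replaced by a constant on one side of a hyperplane
  and kept on the other, up to a small error and away from a thin slab around the hyperplane.
\<close>
lemma cap_step:
  fixes f :: "complex ^ 'n \<Rightarrow> complex"
  assumes f: "bounded_holo f" and u: "norm u = 1" and t: "0 \<le> t" "t \<le> 1"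
    and "0 < \<epsilon>" "0 < \<eta>"
  obtains f' where "bounded_holo f'"
    "\<And>z. z \<in> ball 0 1 \<Longrightarrow> z \<bullet> u \<le> t - \<epsilon> \<Longrightarrow> norm (f' z - f z) \<le> \<eta>"
    "\<And>z. z \<in> ball 0 1 \<Longrightarrow> t + \<epsilon> \<le> z \<bullet> u \<Longrightarrow> norm (f' z - c) \<le> \<eta>"
proof -
  obtain B0 where B0: "0 < B0" "\<And>z. z \<in> ball 0 1 \<Longrightarrow> norm (f z) \<le> B0"
    using f unfolding bounded_holo_def bounded_pos by (auto simp del: mem_ball_0)
  define B where "B = B0 + norm c"
  have B: "0 < B" "\<And>z. z \<in> ball 0 1 \<Longrightarrow> norm (c - f z) \<le> B"
  proof -
    show "0 < B" using B0(1) by (simp add: B_def add_pos_nonneg)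
    show "norm (c - f z) \<le> B" if "z \<in> ball 0 1" for z
      using norm_triangle_ineq4[of c "f z"] B0(2)[OF that] by (simp add: B_def)
  qed
  have "0 < \<eta> / B" using \<open>0 < \<eta>\<close> B by simp
  then obtain h where h: "h holomorphic_on ball 0 1" "bounded (h ` ball 0 1)"
      "\<And>w. w \<in> slit_disc t \<epsilon> \<Longrightarrow> norm (h w - (if t < Re w then 1 else 0)) \<le> \<eta> / B"
    using step_function_approximable[OF t \<open>0 < \<epsilon>\<close>] unfolding approximable_def by blast
  have im: "hform u ` ball 0 1 \<subseteq> ball 0 1"
    using norm_hform_le[of u] u by (force intro: le_less_trans)
  define H where "H z = h (hform u z)" for z
  have H: "bounded_holo H"
  proof -
    have "H ` ball 0 1 \<subseteq> h ` ball 0 1" using im by (auto simp: H_def)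
    then show ?thesis unfolding bounded_holo_def
      using holomorphic_on_cn_compose_hform[OF h(1) open_ball im] bounded_subset[OF h(2)]
      by (simp add: H_def[abs_def])
  qed
  \<comment> \<open>\<open>H\<close> is nearly \<open>0\<close> below the slab and nearly \<open>1\<close> above it, relative to the size \<open>B\<close> of \<open>c - f\<close>.\<close>
  define f' where "f' z = f z + (c + (-1) * f z) * H z" for z
  show thesis
  proof (rule that)
    show "bounded_holo f'" unfolding f'_def[abs_def]
      by (intro bounded_holo_add bounded_holo_mult bounded_holo_const f H)
  next
    fix z :: "complex ^ 'n" assume z: "z \<in> ball 0 1" "z \<bullet> u \<le> t - \<epsilon>"
    then have "hform u z \<in> slit_disc t \<epsilon>" "\<not> t < Re (hform u z)"
      using imageI[OF z(1), of "hform u", THEN subsetD[OF im]] \<open>0 < \<epsilon>\<close>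
      by (auto simp: slit_disc_def Re_hform)
    then have "norm (H z) \<le> \<eta> / B" using h(3) by (force simp: H_def)
    then have "norm (c - f z) * norm (H z) \<le> B * (\<eta> / B)"
      using B z by (intro mult_mono) auto
    then show "norm (f' z - f z) \<le> \<eta>" using B by (simp add: f'_def norm_mult)
  next
    fix z :: "complex ^ 'n" assume z: "z \<in> ball 0 1" "t + \<epsilon> \<le> z \<bullet> u"
    then have "hform u z \<in> slit_disc t \<epsilon>" "t < Re (hform u z)"
      using imageI[OF z(1), of "hform u", THEN subsetD[OF im]] \<open>0 < \<epsilon>\<close>
      by (auto simp: slit_disc_def Re_hform)
    then have "norm (H z - 1) \<le> \<eta> / B" using h(3) by (force simp: H_def)
    then have "norm (c - f z) * norm (H z - 1) \<le> B * (\<eta> / B)"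
      using B z by (intro mult_mono) auto
    moreover have "f' z - c = (c - f z) * (H z - 1)" by (simp add: f'_def algebra_simps)
    ultimately show "norm (f' z - c) \<le> \<eta>" using B by (simp add: norm_mult)
  qed
qed

text \<open>
  The same for finitely many caps, treated one after another: a cap treated later overrides the
  earlier ones, so a point of several caps gets the value of the last cap that contains it.
\<close>
lemma caps_step:
  fixes f :: "complex ^ 'n \<Rightarrow> complex"
  assumes f: "bounded_holo f" and "finite U" and U: "\<And>u. u \<in> U \<Longrightarrow> norm u = 1"
    and t: "0 \<le> t" "t \<le> 1" and "0 < \<epsilon>" "0 < \<eta>"
  shows "\<exists>f'. bounded_holo f' \<and>
    (\<forall>z\<in>ball 0 1. (\<forall>u\<in>U. z \<bullet> u \<le> t - \<epsilon>) \<longrightarrow> norm (f' z - f z) \<le> \<eta>) \<and>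
    (\<forall>z\<in>ball 0 1. (\<forall>u\<in>U. \<epsilon> \<le> \<bar>z \<bullet> u - t\<bar>) \<longrightarrow> (\<exists>u\<in>U. t + \<epsilon> \<le> z \<bullet> u) \<longrightarrow>
       (\<exists>u\<in>U. t + \<epsilon> \<le> z \<bullet> u \<and> norm (f' z - g u) \<le> \<eta>))"
  using \<open>finite U\<close> U \<open>0 < \<eta>\<close>
proof (induction U arbitrary: \<eta>)
  case empty
  then show ?case using f by (intro exI[of _ f]) auto
next
  case (insert v U)
  from insert.prems have "0 < \<eta> / 2" "\<And>u. u \<in> U \<Longrightarrow> norm u = 1" "norm v = 1" by auto
  with insert.IH[of "\<eta> / 2"] obtain f1 where f1: "bounded_holo f1"
    "\<And>z. z \<in> ball 0 1 \<Longrightarrow> (\<And>u. u \<in> U \<Longrightarrow> z \<bullet> u \<le> t - \<epsilon>) \<Longrightarrow> norm (f1 z - f z) \<le> \<eta> / 2"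
    "\<And>z. z \<in> ball 0 1 \<Longrightarrow> (\<And>u. u \<in> U \<Longrightarrow> \<epsilon> \<le> \<bar>z \<bullet> u - t\<bar>) \<Longrightarrow> (\<exists>u\<in>U. t + \<epsilon> \<le> z \<bullet> u) \<Longrightarrow>
       (\<exists>u\<in>U. t + \<epsilon> \<le> z \<bullet> u \<and> norm (f1 z - g u) \<le> \<eta> / 2)"
    by blast
  obtain f2 where f2: "bounded_holo f2"
    "\<And>z. z \<in> ball 0 1 \<Longrightarrow> z \<bullet> v \<le> t - \<epsilon> \<Longrightarrow> norm (f2 z - f1 z) \<le> \<eta> / 2"
    "\<And>z. z \<in> ball 0 1 \<Longrightarrow> t + \<epsilon> \<le> z \<bullet> v \<Longrightarrow> norm (f2 z - g v) \<le> \<eta> / 2"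
    using cap_step[OF f1(1) \<open>norm v = 1\<close> t \<open>0 < \<epsilon>\<close> \<open>0 < \<eta> / 2\<close>, of "g v"] by metis
  have tri: "norm (f2 z - x) \<le> \<eta>" if "norm (f2 z - f1 z) \<le> \<eta> / 2" "norm (f1 z - x) \<le> \<eta> / 2" for z x
    using norm_triangle_ineq[of "f2 z - f1 z" "f1 z - x"] that by simp
  show ?case
  proof (intro exI[of _ f2] conjI ballI impI)
    show "bounded_holo f2" by fact
  next
    fix z :: "complex ^ 'n" assume z: "z \<in> ball 0 1" "\<forall>u\<in>insert v U. z \<bullet> u \<le> t - \<epsilon>"
    then show "norm (f2 z - f z) \<le> \<eta>" using f2(2)[of z] f1(2)[of z] tri by simp
  next
    fix z :: "complex ^ 'n"
    assume z: "z \<in> ball 0 1" "\<forall>u\<in>insert v U. \<epsilon> \<le> \<bar>z \<bullet> u - t\<bar>" "\<exists>u\<in>insert v U. t + \<epsilon> \<le> z \<bullet> u"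
    show "\<exists>u\<in>insert v U. t + \<epsilon> \<le> z \<bullet> u \<and> norm (f2 z - g u) \<le> \<eta>"
    proof (cases "t + \<epsilon> \<le> z \<bullet> v")
      case True
      then show ?thesis using f2(3)[OF z(1) True] \<open>0 < \<eta> / 2\<close> by auto
    next
      case False
      then have "z \<bullet> v \<le> t - \<epsilon>" using z(2) \<open>0 < \<epsilon>\<close> by (auto simp: abs_if split: if_splits)
      moreover obtain u where "u \<in> U" "t + \<epsilon> \<le> z \<bullet> u" "norm (f1 z - g u) \<le> \<eta> / 2"
        using f1(3)[of z] z False by auto
      ultimately show ?thesis using f2(2)[OF z(1)] tri by blast
    qed
  qed
qed

section \<open>Correction on a spherical shell\<close>

lemma slab_measure_small:
  fixes u :: "'a::euclidean_space"
  assumes "norm u = 1" "0 < \<theta>"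
  shows "\<exists>\<epsilon>>0. measure lebesgue {z \<in> ball 0 1. \<bar>z \<bullet> u - t\<bar> < \<epsilon>} \<le> \<theta>"
proof -
  define E where "E n = {z \<in> ball (0::'a) 1. \<bar>z \<bullet> u - t\<bar> < inverse (real (Suc n))}" for n
  have op: "open (E n)" for n
    unfolding E_def mem_ball_0 by (intro open_Collect_conj open_Collect_less continuous_intros)
  have "(\<lambda>n. measure lebesgue (E n)) \<longlonglongrightarrow> measure lebesgue (\<Inter>n. E n)"
  proof (rule Lim_measure_decseq)
    show "range E \<subseteq> sets lebesgue" using op by auto
    show "decseq E"
      unfolding decseq_def E_def by (auto elim!: less_le_trans simp: le_imp_inverse_le)
    show "emeasure lebesgue (E n) \<noteq> \<infinity>" for n
    proof -
      have "bounded (E n)" by (rule bounded_subset[OF bounded_ball[of 0 1]]) (auto simp: E_def)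
      then have "E n \<in> lmeasurable" using op by (rule lmeasurable_open)
      then show ?thesis by (auto simp: fmeasurable_def)
    qed
  qed
  moreover have "negligible (\<Inter>n. E n)"
  proof (rule negligible_subset)
    show "negligible {z. u \<bullet> z = t}" using assms by (intro negligible_hyperplane) auto
    show "(\<Inter>n. E n) \<subseteq> {z. u \<bullet> z = t}"
    proof
      fix z assume z: "z \<in> (\<Inter>n. E n)"
      then have "\<bar>z \<bullet> u - t\<bar> < inverse (real (Suc n))" for n by (auto simp: E_def)
      then have "\<bar>z \<bullet> u - t\<bar> \<le> 0"
        by (meson reals_Archimedean not_le order.asym)
      then show "z \<in> {z. u \<bullet> z = t}" by (simp add: inner_commute)
    qed
  qed
  ultimately have "(\<lambda>n. measure lebesgue (E n)) \<longlonglongrightarrow> 0"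
    by (simp add: negligible_imp_measure0)
  then have "\<forall>\<^sub>F n in sequentially. measure lebesgue (E n) < \<theta>"
    using \<open>0 < \<theta>\<close> by (rule order_tendstoD)
  then obtain n where "measure lebesgue (E n) < \<theta>" by (auto simp: eventually_sequentially)
  then show ?thesis by (intro exI[of _ "inverse (real (Suc n))"]) (auto simp: E_def)
qed

lemma slabs_measure_small:
  fixes U :: "'a::euclidean_space set"
  assumes "finite U" "\<And>u. u \<in> U \<Longrightarrow> norm u = 1" "0 < \<theta>" "0 < \<epsilon>\<^sub>0"
  shows "\<exists>\<epsilon>>0. \<epsilon> \<le> \<epsilon>\<^sub>0 \<and> measure lebesgue {z \<in> ball 0 1. \<exists>u\<in>U. \<bar>z \<bullet> u - t\<bar> < \<epsilon>} \<le> \<theta>"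
  using assms(1-3)
proof (induction U arbitrary: \<theta>)
  case empty
  then show ?case using assms(4) by auto
next
  case (insert v U)
  let ?E = "\<lambda>U \<epsilon>. {z \<in> ball (0::'a) 1. \<exists>u\<in>U. \<bar>z \<bullet> u - t\<bar> < \<epsilon>}"
  have lm: "?E U \<epsilon> \<in> lmeasurable" for U \<epsilon>
  proof (rule lmeasurable_open)
    show "bounded (?E U \<epsilon>)" by (rule bounded_subset[OF bounded_ball[of 0 1]]) auto
    have "?E U \<epsilon> = (\<Union>u\<in>U. {z \<in> ball (0::'a) 1. \<bar>z \<bullet> u - t\<bar> < \<epsilon>})" by auto
    also have "open \<dots>"
      unfolding mem_ball_0
      by (intro open_UN ballI open_Collect_conj open_Collect_less continuous_intros)
    finally show "open (?E U \<epsilon>)" .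
  qed
  have "0 < \<theta> / 2" using insert.prems by simp
  then obtain \<epsilon>1 where e1: "0 < \<epsilon>1" "\<epsilon>1 \<le> \<epsilon>\<^sub>0" "measure lebesgue (?E U \<epsilon>1) \<le> \<theta> / 2"
    using insert.IH[of "\<theta> / 2"] insert.prems by auto
  obtain \<epsilon>2 where e2: "0 < \<epsilon>2" "measure lebesgue (?E {v} \<epsilon>2) \<le> \<theta> / 2"
    using slab_measure_small[OF _ \<open>0 < \<theta> / 2\<close>, of v t] insert.prems by auto
  define \<epsilon> where "\<epsilon> = min \<epsilon>1 \<epsilon>2"
  have "measure lebesgue (?E (insert v U) \<epsilon>) \<le> measure lebesgue (?E U \<epsilon>1 \<union> ?E {v} \<epsilon>2)"
  proof (rule measure_mono_fmeasurable)
    show "?E (insert v U) \<epsilon> \<subseteq> ?E U \<epsilon>1 \<union> ?E {v} \<epsilon>2" by (auto simp: \<epsilon>_def)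
    show "?E (insert v U) \<epsilon> \<in> sets lebesgue" by (rule fmeasurableD[OF lm])
    show "?E U \<epsilon>1 \<union> ?E {v} \<epsilon>2 \<in> lmeasurable" by (rule fmeasurable.Un[OF lm lm])
  qed
  also have "\<dots> \<le> measure lebesgue (?E U \<epsilon>1) + measure lebesgue (?E {v} \<epsilon>2)"
    by (rule measure_Un_le[OF fmeasurableD[OF lm] fmeasurableD[OF lm]])
  also have "\<dots> \<le> \<theta>" using e1 e2 by simp
  finally have "measure lebesgue (?E (insert v U) \<epsilon>) \<le> \<theta>" .
  moreover have "0 < \<epsilon>" "\<epsilon> \<le> \<epsilon>\<^sub>0" using e1 e2 by (auto simp: \<epsilon>_def)
  ultimately show ?case by blast
qed

text \<open>
  The caps are cut off by hyperplanes tangent to a sphere of radius between \<open>a\<close> and \<open>b\<close> and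
  cover the part \<open>b \<le> \<bar>z\<bar> < 1\<close> of the ball; \<open>E\<close> is the union of the slabs. A cap with pole \<open>u\<close>
  receives the value \<open>g u\<close>. Between the radii \<open>a\<close> and \<open>b\<close> a point may lie in no cap, and then
  the old value is kept. No relation between \<open>\<theta>\<close> and the other parameters is needed, because
  the width of the slabs is chosen after the caps.
\<close>
lemma shell_step:
  fixes f :: "complex ^ 'n \<Rightarrow> complex"
  assumes f: "bounded_holo f" and ab: "0 < a" "a < b" "b < 1" and "0 < \<eta>" "0 < \<theta>"
  shows "\<exists>f' E. bounded_holo f' \<and> E \<in> lmeasurable \<and> measure lebesgue E \<le> \<theta> \<and>
    (\<forall>z. norm z \<le> a \<longrightarrow> norm (f' z - f z) \<le> \<eta>) \<and>
    (\<forall>z\<in>ball 0 1 - E. (norm z < b \<and> norm (f' z - f z) \<le> \<eta>) \<or>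
       (\<exists>u. norm u = 1 \<and> norm (z - u) \<le> sqrt (2 * (1 - a)) \<and> norm (f' z - g u) \<le> \<eta>))"
proof -
  define t where "t = (a + b) / 2"
  define \<delta> where "\<delta> = sqrt ((b - a) / 2)"
  have "0 < \<delta>" using ab by (simp add: \<delta>_def)
  then obtain U where U: "finite U" "U \<subseteq> sphere (0 :: complex ^ 'n) 1" "sphere 0 1 \<subseteq> (\<Union>u\<in>U. ball u \<delta>)"
    using seq_compact_imp_totally_bounded[of "sphere (0 :: complex ^ 'n) 1"]
    by (metis compact_eq_seq_compact_metric compact_sphere)
  have U1: "norm u = 1" if "u \<in> U" for u using U(2) that by auto
  obtain \<epsilon> where \<epsilon>: "0 < \<epsilon>" "\<epsilon> \<le> (b - a) / 4"
    "measure lebesgue {z \<in> ball 0 1. \<exists>u\<in>U. \<bar>z \<bullet> u - t\<bar> < \<epsilon>} \<le> \<theta>"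
    using slabs_measure_small[OF U(1) U1 \<open>0 < \<theta>\<close>, of "(b - a) / 4" t] ab by auto
  define E where "E = {z \<in> ball 0 1. \<exists>u\<in>U. \<bar>z \<bullet> u - t\<bar> < \<epsilon>}"
  have t: "0 \<le> t" "t \<le> 1" using ab by (auto simp: t_def)
  obtain f' where f': "bounded_holo f'"
    "\<And>z. z \<in> ball 0 1 \<Longrightarrow> (\<And>u. u \<in> U \<Longrightarrow> z \<bullet> u \<le> t - \<epsilon>) \<Longrightarrow> norm (f' z - f z) \<le> \<eta>"
    "\<And>z. z \<in> ball 0 1 \<Longrightarrow> (\<And>u. u \<in> U \<Longrightarrow> \<epsilon> \<le> \<bar>z \<bullet> u - t\<bar>) \<Longrightarrow> (\<exists>u\<in>U. t + \<epsilon> \<le> z \<bullet> u) \<Longrightarrow>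
       (\<exists>u\<in>U. t + \<epsilon> \<le> z \<bullet> u \<and> norm (f' z - g u) \<le> \<eta>)"
    using caps_step[OF f U(1) U1 t \<epsilon>(1) \<open>0 < \<eta>\<close>, of g] by blast
  have "E \<in> lmeasurable"
  proof (rule lmeasurable_open)
    show "bounded E" by (rule bounded_subset[OF bounded_ball[of 0 1]]) (auto simp: E_def)
    have "E = (\<Union>u\<in>U. {z \<in> ball 0 1. \<bar>z \<bullet> u - t\<bar> < \<epsilon>})" by (auto simp: E_def)
    also have "open \<dots>"
      unfolding mem_ball_0
      by (intro open_UN ballI open_Collect_conj open_Collect_less continuous_intros)
    finally show "open E" .
  qed
  moreover have "norm (f' z - f z) \<le> \<eta>" if z: "norm z \<le> a" for z
  proof (rule f'(2))
    show "z \<in> ball 0 1" using z ab by simp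
    fix u assume "u \<in> U"
    then have "z \<bullet> u \<le> norm z" using norm_cauchy_schwarz[of z u] U1 by simp
    also have "\<dots> \<le> t - \<epsilon>" using z \<epsilon>(2) ab by (simp add: t_def field_simps)
    finally show "z \<bullet> u \<le> t - \<epsilon>" .
  qed
  moreover have "(norm z < b \<and> norm (f' z - f z) \<le> \<eta>) \<or>
       (\<exists>u. norm u = 1 \<and> norm (z - u) \<le> sqrt (2 * (1 - a)) \<and> norm (f' z - g u) \<le> \<eta>)"
    if z: "z \<in> ball 0 1 - E" for z
  proof (cases "\<exists>u\<in>U. t + \<epsilon> \<le> z \<bullet> u")
    case True
    have "\<epsilon> \<le> \<bar>z \<bullet> u - t\<bar>" if "u \<in> U" for u using z that by (auto simp: E_def not_less)
    then obtain u where u: "u \<in> U" "t + \<epsilon> \<le> z \<bullet> u" "norm (f' z - g u) \<le> \<eta>"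
      using f'(3)[OF _ _ True] z by auto
    have "norm (z - u) ^ 2 = norm z ^ 2 + 1 - 2 * (z \<bullet> u)"
      using U1[OF u(1)] by (simp add: power2_norm_eq_inner inner_diff inner_commute norm_eq_1)
    also have "\<dots> \<le> 1 + 1 - 2 * a"
    proof -
      have "norm z ^ 2 \<le> 1" using z by (simp add: power_le_one)
      moreover have "a \<le> z \<bullet> u" using u(2) \<epsilon>(1) ab by (simp add: t_def field_simps)
      ultimately show ?thesis by simp
    qed
    finally have "norm (z - u) \<le> sqrt (2 * (1 - a))" by (simp add: real_le_rsqrt)
    with u U1 show ?thesis by blast
  next
    case False
    have "z \<bullet> u \<le> t - \<epsilon>" if "u \<in> U" for u
    proof -
      have "\<epsilon> \<le> \<bar>z \<bullet> u - t\<bar>" "\<not> t + \<epsilon> \<le> z \<bullet> u" using z that False by (auto simp: E_def not_less)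
      then show ?thesis by linarith
    qed
    then have "norm (f' z - f z) \<le> \<eta>" using f'(2) z by auto
    moreover have "norm z < b"
    proof (rule ccontr)
      assume "\<not> norm z < b"
      then have bz: "b \<le> norm z" by simp
      define x where "x = z /\<^sub>R norm z"
      have nz: "norm z \<noteq> 0" using bz ab by auto
      then have x: "norm x = 1" "z = norm z *\<^sub>R x" by (auto simp: x_def)
      then have "x \<in> (\<Union>u\<in>U. ball u \<delta>)" by (intro subsetD[OF U(3)]) simp
      then obtain u where u: "u \<in> U" "norm (x - u) < \<delta>" by (auto simp: dist_norm norm_minus_commute)
      have "norm (x - u) ^ 2 = 2 - 2 * (x \<bullet> u)"
        using U1[OF u(1)] x(1) by (simp add: power2_norm_eq_inner inner_diff inner_commute norm_eq_1)
      moreover have "norm (x - u) ^ 2 \<le> \<delta> ^ 2" using u(2) by (intro power_mono) auto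
      moreover have "\<delta> ^ 2 = (b - a) / 2" using ab by (simp add: \<delta>_def)
      ultimately have xu: "1 - (b - a) / 4 \<le> x \<bullet> u" by linarith
      have "t + \<epsilon> \<le> b - (b - a) / 4" using \<epsilon>(2) by (simp add: t_def field_simps)
      also have "\<dots> \<le> b * (1 - (b - a) / 4)"
      proof -
        have "b * (b - a) \<le> 1 * (b - a)" using ab by (intro mult_right_mono) auto
        then have "b * ((b - a) / 4) \<le> (b - a) / 4" by simp
        then show ?thesis unfolding right_diff_distrib by simp
      qed
      also have "\<dots> \<le> norm z * (x \<bullet> u)" using bz xu ab by (intro mult_mono) auto
      also have "\<dots> = z \<bullet> u" by (subst x(2)) simp
      finally show False using False u(1) by auto
    qed
    ultimately show ?thesis by blast
  qed
  moreover have "measure lebesgue E \<le> \<theta>" using \<epsilon>(3) by (simp add: E_def)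
  ultimately show ?thesis using f'(1) by blast
qed

section \<open>Locally uniform limits of holomorphic functions\<close>

text \<open>The Cauchy estimate, applied on the complex line through \<open>x\<close> in direction \<open>v\<close>.\<close>
lemma has_derivative_bound_cn:
  fixes f :: "complex ^ 'n \<Rightarrow> complex"
  assumes f: "holomorphic_on_cn f (ball x s)" and D: "(f has_derivative D) (at x)" "\<And>c v. D (c *s v) = c * D v"
    and s: "0 < s" and M: "\<And>y. y \<in> ball x s \<Longrightarrow> norm (f y) \<le> M"
  shows "norm (D v) \<le> 2 * M / s * norm v"
proof (cases "v = 0")
  case True
  then show ?thesis using has_derivative_bounded_linear[OF D(1)] by (simp add: linear_simps)
next
  case False
  define R where "R = s / norm v"
  have R: "0 < R" using False s by (simp add: R_def)
  define q where "q \<zeta> = f (x + \<zeta> *s v)" for \<zeta>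
  have bl: "bounded_linear (\<lambda>\<zeta>. \<zeta> *s v)"
  proof (rule bounded_linear_intro)
    show "norm (\<zeta> *s v) \<le> norm \<zeta> * norm v" for \<zeta> by (simp add: norm_vector_scalar_mult)
  qed (auto simp: vec_eq_iff algebra_simps)
  have line: "((\<lambda>\<zeta>. x + \<zeta> *s v) has_derivative (\<lambda>\<zeta>. \<zeta> *s v)) (at \<zeta>)" for \<zeta>
    using has_derivative_add[OF has_derivative_const bounded_linear.has_derivative[OF bl has_derivative_ident]] by simp
  have mem: "x + \<zeta> *s v \<in> ball x s" if "norm \<zeta> < R" for \<zeta>
    using that False by (simp add: dist_norm norm_vector_scalar_mult R_def field_simps)
  have qd: "(q has_field_derivative E v) (at \<zeta>)"
    if E: "(f has_derivative E) (at (x + \<zeta> *s v))" "\<And>c v. E (c *s v) = c * E v" for \<zeta> E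
    using has_derivative_compose[OF line E(1)]
    by (simp add: has_field_derivative_def q_def[abs_def] E(2) mult.commute[of _ "E v"])
  have qh: "q holomorphic_on ball 0 R"
    unfolding holomorphic_on_def
  proof
    fix \<zeta> :: complex assume "\<zeta> \<in> ball 0 R"
    then have "x + \<zeta> *s v \<in> ball x s" using mem by simp
    then obtain E where "(f has_derivative E) (at (x + \<zeta> *s v))" "\<And>c v. E (c *s v) = c * E v"
      using f unfolding holomorphic_on_cn_def by blast
    from qd[OF this] show "q field_differentiable at \<zeta> within ball 0 R"
      using field_differentiable_at_within field_differentiable_def by blast
  qed
  have "norm ((deriv ^^ 1) q 0) \<le> fact 1 * M / (R / 2) ^ 1"
  proof (rule Cauchy_inequality)
    show "q holomorphic_on ball 0 (R / 2)" using R by (intro holomorphic_on_subset[OF qh]) auto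
    have "q holomorphic_on cball 0 (R / 2)" using R by (intro holomorphic_on_subset[OF qh]) auto
    then show "continuous_on (cball 0 (R / 2)) q" by (rule holomorphic_on_imp_continuous_on)
    show "norm (q \<zeta>) \<le> M" if "norm (0 - \<zeta>) = R / 2" for \<zeta>
      unfolding q_def using that R by (intro M mem) simp
  qed (use R in auto)
  moreover have "deriv q 0 = D v" using D by (intro DERIV_imp_deriv qd) auto
  ultimately show ?thesis using False s by (simp add: R_def field_simps)
qed

lemma holomorphic_on_cn_subset: "holomorphic_on_cn f S \<Longrightarrow> T \<subseteq> S \<Longrightarrow> holomorphic_on_cn f T"
  by (auto simp: holomorphic_on_cn_def)

text \<open>
  By the Cauchy estimate the derivatives converge locally uniformly as well, so the limit is
  differentiable, and its derivative is complex linear as a limit of complex linear maps.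
\<close>
lemma holomorphic_on_cn_uniform_limit:
  fixes f :: "nat \<Rightarrow> complex ^ 'n \<Rightarrow> complex"
  assumes f: "\<And>n. holomorphic_on_cn (f n) (ball 0 1)"
    and lim: "\<And>r. r < 1 \<Longrightarrow> uniform_limit (ball 0 r) f F sequentially"
  shows "holomorphic_on_cn F (ball 0 1)"
  unfolding holomorphic_on_cn_def
proof
  fix z :: "complex ^ 'n" assume z: "z \<in> ball 0 1"
  define s where "s = (1 - norm z) / 3"
  have s: "0 < s" using z by (simp add: s_def)
  have sub: "ball x s \<subseteq> ball 0 (1 - s)" if "x \<in> ball z s" for x
  proof
    fix y assume "y \<in> ball x s"
    then have "dist 0 y < norm z + s + s"
      using that dist_triangle[of 0 y x] dist_triangle[of 0 x z] by simp
    then show "y \<in> ball 0 (1 - s)" by (simp add: s_def field_simps)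
  qed
  have sub1: "ball 0 (1 - s) \<subseteq> ball (0 :: complex ^ 'n) 1" using s by auto
  have self: "x \<in> ball 0 1" if "x \<in> ball z s" for x
    using sub[OF that] sub1 s centre_in_ball by blast
  have "\<forall>n. \<forall>x\<in>ball 0 1. \<exists>D. (f n has_derivative D) (at x) \<and> (\<forall>c v. D (c *s v) = c * D v)"
    using f unfolding holomorphic_on_cn_def by blast
  then obtain D where D: "\<And>n x. x \<in> ball 0 1 \<Longrightarrow> (f n has_derivative D n x) (at x)"
    "\<And>n x c v. x \<in> ball 0 1 \<Longrightarrow> D n x (c *s v) = c * D n x v" by metis
  have cauchy: "\<exists>N. \<forall>m\<ge>N. \<forall>n\<ge>N. \<forall>x\<in>ball z s. \<forall>v. norm (D m x v - D n x v) \<le> e * norm v"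
    if e: "0 < e" for e
  proof -
    have "\<forall>\<^sub>F n in sequentially. \<forall>y\<in>ball 0 (1 - s). dist (f n y) (F y) < e * s / 4"
      using lim[of "1 - s", unfolded uniform_limit_iff] s e
      by (auto elim!: allE[of _ "e * s / 4"] simp del: mem_ball_0 times_divide_eq_left)
    then obtain N where N: "\<And>n y. N \<le> n \<Longrightarrow> y \<in> ball 0 (1 - s) \<Longrightarrow> dist (f n y) (F y) < e * s / 4"
      unfolding eventually_sequentially by blast
    show ?thesis
    proof (intro exI[of _ N] allI impI ballI)
      fix m n x v assume mn: "N \<le> m" "N \<le> n" and x: "x \<in> ball z s"
      have "norm ((\<lambda>v. D m x v - D n x v) v) \<le> 2 * (e * s / 2) / s * norm v"
      proof (rule has_derivative_bound_cn[where f = "\<lambda>y. f m y - f n y"])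
        show "holomorphic_on_cn (\<lambda>y. f m y - f n y) (ball x s)"
          using f sub[OF x] sub1 by (intro holomorphic_on_cn_subset[OF holomorphic_on_cn_diff]) blast+
        show "((\<lambda>y. f m y - f n y) has_derivative (\<lambda>v. D m x v - D n x v)) (at x)"
          using D(1)[OF self[OF x]] by (intro has_derivative_diff)
        show "D m x (c *s v) - D n x (c *s v) = c * (D m x v - D n x v)" for c v
          by (simp add: D(2)[OF self[OF x]] right_diff_distrib)
        show "norm (f m y - f n y) \<le> e * s / 2" if "y \<in> ball x s" for y
        proof -
          have "y \<in> ball 0 (1 - s)" using sub[OF x] that by blast
          from N[OF mn(1) this] N[OF mn(2) this] show ?thesis
            using dist_triangle2[of "f m y" "f n y" "F y"] by (simp add: dist_norm)
        qed
      qed (rule s)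
      then show "norm (D m x v - D n x v) \<le> e * norm v" using s by simp
    qed
  qed
  define D' where "D' x v = lim (\<lambda>n. D n x v)" for x v
  have D': "(\<lambda>n. D n x v) \<longlonglongrightarrow> D' x v" if x: "x \<in> ball z s" for x v
  proof -
    have "Cauchy (\<lambda>n. D n x v)"
    proof (rule metric_CauchyI)
      fix e :: real assume "0 < e"
      then have "0 < e / (norm v + 1)" by (simp add: add_nonneg_pos)
      from cauchy[OF this] obtain N where N: "\<And>m n. N \<le> m \<Longrightarrow> N \<le> n \<Longrightarrow>
          norm (D m x v - D n x v) \<le> e / (norm v + 1) * norm v" using x by blast
      have "e / (norm v + 1) * norm v < e" using \<open>0 < e\<close>
        by (simp add: divide_less_eq add_nonneg_pos)
      then show "\<exists>M. \<forall>m\<ge>M. \<forall>n\<ge>M. dist (D m x v) (D n x v) < e"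
        using N by (auto simp: dist_norm intro!: exI[of _ N] intro: le_less_trans)
    qed
    then show ?thesis unfolding D'_def by (simp add: Cauchy_convergent convergent_LIMSEQ_iff[symmetric])
  qed
  have "\<exists>g. \<forall>x\<in>ball z s. (\<lambda>n. f n x) \<longlonglongrightarrow> g x \<and> (g has_derivative D' x) (at x within ball z s)"
  proof (rule has_derivative_sequence)
    show "(f n has_derivative D n x) (at x within ball z s)" if "x \<in> ball z s" for n x
      using D(1)[OF self[OF that]] by (rule has_derivative_at_withinI)
    show "\<forall>\<^sub>F n in sequentially. \<forall>x\<in>ball z s. \<forall>h. norm (D n x h - D' x h) \<le> e * norm h"
      if e: "0 < e" for e
    proof -
      obtain N where N: "\<And>m n x v. N \<le> m \<Longrightarrow> N \<le> n \<Longrightarrow> x \<in> ball z s \<Longrightarrow>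
          norm (D m x v - D n x v) \<le> e * norm v" using cauchy[OF e] by blast
      show ?thesis
      proof (rule eventually_sequentiallyI[of N], intro ballI allI)
        fix n x h assume n: "N \<le> n" and x: "x \<in> ball z s"
        show "norm (D n x h - D' x h) \<le> e * norm h"
        proof (rule Lim_bounded)
          show "(\<lambda>m. norm (D n x h - D m x h)) \<longlonglongrightarrow> norm (D n x h - D' x h)"
            by (intro tendsto_intros D' x)
          show "\<forall>m\<ge>N. norm (D n x h - D m x h) \<le> e * norm h" using N n x by blast
        qed
      qed
    qed
    show "z \<in> ball z s" using s by simp
    show "(\<lambda>n. f n z) \<longlonglongrightarrow> F z"
      by (rule tendsto_uniform_limitI[OF lim[of "1 - s"]]) (use s in \<open>auto simp: s_def field_simps\<close>)
  qed simp
  then obtain g where g: "\<And>x. x \<in> ball z s \<Longrightarrow> (\<lambda>n. f n x) \<longlonglongrightarrow> g x"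
    "\<And>x. x \<in> ball z s \<Longrightarrow> (g has_derivative D' x) (at x within ball z s)" by blast
  have gF: "g x = F x" if x: "x \<in> ball z s" for x
  proof -
    have "x \<in> ball 0 (1 - s)" using sub[OF x] s centre_in_ball by blast
    then have "(\<lambda>n. f n x) \<longlonglongrightarrow> F x" using s by (intro tendsto_uniform_limitI[OF lim[of "1 - s"]]) auto
    with g(1)[OF x] show ?thesis by (rule LIMSEQ_unique)
  qed
  have zs: "z \<in> ball z s" using s by simp
  have "(g has_derivative D' z) (at z)"
    using g(2)[OF zs] zs by (metis at_within_open open_ball)
  then have "(F has_derivative D' z) (at z)"
    by (rule has_derivative_transform_within_open[OF _ open_ball zs gF])
  moreover have "D' z (c *s v) = c * D' z v" for c v
  proof (rule LIMSEQ_unique)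
    show "(\<lambda>n. D n z (c *s v)) \<longlonglongrightarrow> D' z (c *s v)" by (rule D'[OF zs])
    show "(\<lambda>n. D n z (c *s v)) \<longlonglongrightarrow> c * D' z v"
      unfolding D(2)[OF z] by (intro tendsto_intros D' zs)
  qed
  ultimately show "\<exists>D. (F has_derivative D) (at z) \<and> (\<forall>c v. D (c *s v) = c * D v)" by blast
qed

section \<open>Lusin approximation on the sphere\<close>

lemma compact_inner_approximation:
  fixes M :: "'a::{second_countable_topology, complete_space} measure"
  assumes M: "sets M = sets borel" "finite_measure M" and B: "B \<in> sets borel" and "0 < e"
  obtains K where "compact K" "K \<subseteq> B" "measure M (B - K) \<le> e"
proof -
  interpret finite_measure M by fact
  show thesis
  proof (cases "measure M B \<le> e")
    case True
    then show ?thesis by (intro that[of "{}"]) auto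
  next
    case False
    then have "ennreal (measure M B - e) < emeasure M B"
      using \<open>0 < e\<close> by (auto simp: emeasure_eq_measure intro: ennreal_lessI)
    also have "\<dots> = (SUP K \<in> {K. K \<subseteq> B \<and> compact K}. emeasure M K)"
      by (rule inner_regular[OF M(1) _ B]) simp
    finally obtain K where K: "K \<subseteq> B" "compact K" "ennreal (measure M B - e) < emeasure M K"
      by (auto simp: less_SUP_iff)
    have "measure M B - e \<le> measure M K"
      using K(3) ennreal_leI[of "measure M K" "measure M B - e"]
      unfolding emeasure_eq_measure by (meson not_le less_imp_le)
    moreover have "measure M (B - K) = measure M B - measure M K"
      using K B M(1) by (intro finite_measure_Diff) (auto intro: borel_compact)
    ultimately show ?thesis using K by (intro that[of K]) auto
  qed
qed

text \<open>
  Lusin's theorem. Each preimage \<open>S n\<close> of a basic open set, and its complement, is filled by a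
  compact set up to small measure. On the intersection \<open>K\<close> of the unions \<open>C n \<union> C' n\<close> the set
  \<open>S n\<close> coincides with the open set \<open>- C' n\<close>.
\<close>
theorem lusin:
  fixes M :: "'a::{second_countable_topology, complete_space} measure"
    and \<psi> :: "'a \<Rightarrow> 'b::second_countable_topology"
  assumes M: "sets M = sets borel" "finite_measure M" and \<psi>: "\<psi> \<in> borel_measurable borel"
    and e: "0 < e"
  obtains K where "closed K" "continuous_on K \<psi>" "measure M (- K) \<le> e"
proof -
  interpret finite_measure M by fact
  obtain B :: "'b set set" where B: "countable B" "topological_basis B"
    using ex_countable_basis by blast
  \<comment> \<open>Inserting \<open>UNIV\<close> makes the countable basis nonempty, hence the range of a sequence.\<close>
  define U where "U = from_nat_into (insert UNIV B)"
  have U: "range U = insert UNIV B" using B(1) by (simp add: U_def)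
  have Uo: "open (U n)" for n
  proof -
    have "U n \<in> insert UNIV B" using U by blast
    then show ?thesis using B(2) topological_basis_open by auto
  qed
  define S where "S n = \<psi> -` U n" for n
  have S: "S n \<in> sets borel" for n
    using measurable_sets[OF \<psi>, of "U n"] Uo by (simp add: S_def)
  have "\<exists>C C'. compact C \<and> C \<subseteq> S n \<and> measure M (S n - C) \<le> e / 4 * (1/2) ^ n \<and>
      compact C' \<and> C' \<subseteq> - S n \<and> measure M (- S n - C') \<le> e / 4 * (1/2) ^ n" for n
  proof -
    have "0 < e / 4 * (1/2) ^ n" using e by simp
    obtain C where "compact C" "C \<subseteq> S n" "measure M (S n - C) \<le> e / 4 * (1/2) ^ n"
      using compact_inner_approximation[OF M S \<open>0 < e / 4 * (1/2) ^ n\<close>] .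
    moreover obtain C' where "compact C'" "C' \<subseteq> - S n" "measure M (- S n - C') \<le> e / 4 * (1/2) ^ n"
      using compact_inner_approximation[OF M borel_comp[OF S] \<open>0 < e / 4 * (1/2) ^ n\<close>] .
    ultimately show ?thesis by (intro exI[of _ C] exI[of _ C']) simp
  qed
  then obtain C C' where C: "\<And>n. compact (C n)" "\<And>n. C n \<subseteq> S n"
      "\<And>n. measure M (S n - C n) \<le> e / 4 * (1/2) ^ n"
    and C': "\<And>n. compact (C' n)" "\<And>n. C' n \<subseteq> - S n"
      "\<And>n. measure M (- S n - C' n) \<le> e / 4 * (1/2) ^ n"
    by metis
  define K where "K = (\<Inter>n. C n \<union> C' n)"
  define D where "D n = (S n - C n) \<union> (- S n - C' n)" for n
  have meas: "S n - C n \<in> sets M" "- S n - C' n \<in> sets M" for n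
    unfolding M(1) using sets.Diff[OF S borel_compact[OF C(1)]]
      sets.Diff[OF borel_comp[OF S] borel_compact[OF C'(1)]] by blast+
  then have D: "D n \<in> sets M" for n by (auto simp: D_def)
  have Dm: "measure M (D n) \<le> e / 2 * (1/2) ^ n" for n
    using measure_Un_le[OF meas, of n n] C(3)[of n] C'(3)[of n] by (simp add: D_def)
  show thesis
  proof (rule that)
    show "closed K" unfolding K_def using C(1) C'(1)
      by (intro closed_INT ballI closed_Un compact_imp_closed)
    show "continuous_on K \<psi>"
      unfolding continuous_on_open_invariant
    proof (intro allI impI)
      fix V :: "'b set" assume V: "open V"
      show "\<exists>A. open A \<and> A \<inter> K = \<psi> -` V \<inter> K"
      proof (intro exI conjI)
        show "open (\<Union>n\<in>{n. U n \<subseteq> V}. - C' n)"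
          using C'(1) by (intro open_UN ballI open_Compl compact_imp_closed)
        show "(\<Union>n\<in>{n. U n \<subseteq> V}. - C' n) \<inter> K = \<psi> -` V \<inter> K"
        proof (intro equalityI subsetI)
          fix x assume "x \<in> (\<Union>n\<in>{n. U n \<subseteq> V}. - C' n) \<inter> K"
          then obtain n where "U n \<subseteq> V" "x \<notin> C' n" "x \<in> K" by blast
          moreover from this have "x \<in> S n" using C(2)[of n] unfolding K_def by blast
          ultimately show "x \<in> \<psi> -` V \<inter> K" by (auto simp: S_def)
        next
          fix x assume x: "x \<in> \<psi> -` V \<inter> K"
          then obtain W where "W \<in> B" "\<psi> x \<in> W" "W \<subseteq> V"
            using topological_basisE[OF B(2) V, of "\<psi> x"] by auto
          moreover have "W \<in> range U" using U \<open>W \<in> B\<close> by blast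
          ultimately obtain n where n: "\<psi> x \<in> U n" "U n \<subseteq> V" by blast
          then have "x \<notin> C' n" using C'(2)[of n] by (auto simp: S_def)
          with n x show "x \<in> (\<Union>n\<in>{n. U n \<subseteq> V}. - C' n) \<inter> K" by blast
        qed
      qed
    qed
    have "- K \<subseteq> (\<Union>n. D n)" by (auto simp: K_def D_def)
    moreover have "(\<Union>n. D n) \<in> sets M" using D by blast
    ultimately have "measure M (- K) \<le> measure M (\<Union>n. D n)" by (intro finite_measure_mono)
    also have sm: "summable (\<lambda>n. e / 2 * (1/2) ^ n)" by (intro summable_mult summable_geometric) auto
    then have "summable (\<lambda>n. measure M (D n))"
      by (rule summable_comparison_test'[of _ 0]) (use Dm in auto)
    then have "measure M (\<Union>n. D n) \<le> (\<Sum>n. measure M (D n))"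
      using D by (intro finite_measure_subadditive_countably) auto
    also have "\<dots> \<le> (\<Sum>n. e / 2 * (1/2) ^ n)"
      by (rule suminf_le[OF Dm \<open>summable (\<lambda>n. measure M (D n))\<close> sm])
    also have "\<dots> = e" by (subst suminf_mult) (auto simp: suminf_geometric)
    finally show "measure M (- K) \<le> e" .
  qed
qed

lemma finite_measure_sphere_measure: "finite_measure (sphere_measure :: 'a::euclidean_space measure)"
  by (rule finite_measureI) (simp add: emeasure_sphere_measure_sphere)

text \<open>
  Every \<open>g n\<close> extends the restriction of \<open>\<psi>\<close> to the union of \<open>F\<^sub>0\<close> and a closed set \<open>K n\<close> disjoint
  from \<open>F\<^sub>0\<close>, on which \<open>\<psi>\<close> is continuous by Lusin's theorem and whose complement in
  \<open>sphere 0 1 - F\<^sub>0\<close> has measure at most \<open>(1/2) ^ n\<close>. By the Borel-Cantelli lemma almost every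
  point outside \<open>F\<^sub>0\<close> belongs to all but finitely many of the \<open>K n\<close>.
\<close>
lemma continuous_approximation_on_sphere:
  fixes \<psi> :: "'a::euclidean_space \<Rightarrow> 'b::euclidean_space"
  assumes \<psi>: "\<psi> \<in> borel_measurable (restrict_space borel (sphere 0 1))"
    and F0: "closed F\<^sub>0" "F\<^sub>0 \<subseteq> sphere 0 1" "continuous_on F\<^sub>0 \<psi>"
  obtains g F where "\<And>n::nat. continuous_on UNIV (g n)" "F\<^sub>0 \<subseteq> F" "F \<subseteq> sphere 0 1"
    "sphere 0 1 - F \<in> null_sets sphere_measure" "\<And>p. p \<in> F \<Longrightarrow> (\<lambda>n. g n p) \<longlonglongrightarrow> \<psi> p"
proof -
  let ?S = "sphere (0::'a) 1"
  \<comment> \<open>Regularity concerns measures on all Borel sets of the ambient space, so the measure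
      and the function are transported there.\<close>
  define \<mu> where "\<mu> = distr sphere_measure borel (\<lambda>x::'a. x)"
  have idm: "(\<lambda>x::'a. x) \<in> measurable sphere_measure borel"
    by (simp add: measurable_cong_sets[OF sets_sphere_measure refl] measurable_restrict_space1)
  interpret sph: finite_measure "sphere_measure :: 'a measure" by (rule finite_measure_sphere_measure)
  have \<mu>: "sets \<mu> = sets borel" "finite_measure \<mu>"
    unfolding \<mu>_def using idm by (auto intro: sph.finite_measure_distr)
  interpret \<mu>: finite_measure \<mu> by fact
  define \<psi>' where "\<psi>' x = (if x \<in> ?S then \<psi> x else 0)" for x
  have \<psi>': "\<psi>' \<in> borel_measurable borel"
    using \<psi> unfolding \<psi>'_def[abs_def] by (subst (asm) measurable_restrict_space_iff[of _ _ 0]) auto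
  have S: "?S - F\<^sub>0 \<in> sets borel" using F0(1) by (intro sets.Diff) auto
  have "\<exists>K. closed K \<and> K \<subseteq> ?S - F\<^sub>0 \<and> continuous_on K \<psi> \<and> measure \<mu> (?S - F\<^sub>0 - K) \<le> (1/2) ^ n" for n :: nat
  proof -
    have pos: "0 < (1/2) ^ n / (2::real)" by simp
    obtain K where K: "closed K" "continuous_on K \<psi>'" "measure \<mu> (- K) \<le> (1/2) ^ n / 2"
      using lusin[OF \<mu> \<psi>' pos] .
    obtain C where C: "compact C" "C \<subseteq> ?S - F\<^sub>0" "measure \<mu> (?S - F\<^sub>0 - C) \<le> (1/2) ^ n / 2"
      using compact_inner_approximation[OF \<mu> S pos] .
    have sets: "- K \<in> sets \<mu>" "?S - F\<^sub>0 - C \<in> sets \<mu>"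
      unfolding \<mu>(1) using borel_comp[OF borel_closed[OF K(1)]]
        sets.Diff[OF S borel_compact[OF C(1)]] by blast+
    have "measure \<mu> (?S - F\<^sub>0 - (K \<inter> C)) \<le> measure \<mu> (- K \<union> (?S - F\<^sub>0 - C))"
      by (intro \<mu>.finite_measure_mono sets.Un sets) blast
    also have "\<dots> \<le> measure \<mu> (- K) + measure \<mu> (?S - F\<^sub>0 - C)"
      by (rule measure_Un_le[OF sets])
    also have "\<dots> \<le> (1/2) ^ n" using K C by simp
    finally have "measure \<mu> (?S - F\<^sub>0 - (K \<inter> C)) \<le> (1/2) ^ n" .
    moreover have "continuous_on (K \<inter> C) \<psi>"
    proof (rule continuous_on_eq)
      show "continuous_on (K \<inter> C) \<psi>'" by (rule continuous_on_subset[OF K(2)]) auto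
      show "\<psi>' x = \<psi> x" if "x \<in> K \<inter> C" for x using that C(2) by (auto simp: \<psi>'_def)
    qed
    ultimately show ?thesis using K(1) C by (intro exI[of _ "K \<inter> C"]) (auto intro: compact_imp_closed)
  qed
  then obtain K where K: "\<And>n. closed (K n)" "\<And>n. K n \<subseteq> ?S - F\<^sub>0" "\<And>n. continuous_on (K n) \<psi>"
    "\<And>n::nat. measure \<mu> (?S - F\<^sub>0 - K n) \<le> (1/2) ^ n" by metis
  have "\<exists>g. continuous_on UNIV g \<and> (\<forall>x\<in>F\<^sub>0 \<union> K n. g x = \<psi> x)" for n
  proof -
    have "continuous_on (F\<^sub>0 \<union> K n) \<psi>" using F0 K by (intro continuous_on_closed_Un)
    moreover have "closedin (top_of_set UNIV) (F\<^sub>0 \<union> K n)"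
      using closed_Un[OF F0(1) K(1)] by (simp add: closed_closedin[symmetric])
    ultimately show ?thesis using Tietze_unbounded by metis
  qed
  then obtain g where g: "\<And>n. continuous_on UNIV (g n)" "\<And>n x. x \<in> F\<^sub>0 \<union> K n \<Longrightarrow> g n x = \<psi> x" by metis
  define A where "A n = ?S - F\<^sub>0 - K n" for n
  have A: "A n \<in> sets \<mu>" for n unfolding A_def using S K(1) \<mu>(1) by auto
  have "limsup A \<in> null_sets \<mu>"
  proof (rule borel_cantelli_limsup1)
    show "emeasure \<mu> (A n) < \<infinity>" for n
      unfolding infinity_ennreal_def
      by (rule top.not_eq_extremum[THEN iffD1, OF \<mu>.emeasure_finite])
    show "summable (\<lambda>n. measure \<mu> (A n))"
      by (rule summable_comparison_test'[OF summable_geometric, of "1/2" 0]) (use K(4) in \<open>auto simp: A_def\<close>)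
  qed (rule A)
  moreover have "limsup A \<subseteq> ?S - F\<^sub>0"
  proof -
    have "limsup A \<subseteq> (\<Union>n. A n)" by (auto simp: limsup_INF_SUP)
    then show ?thesis by (auto simp: A_def)
  qed
  moreover from this have "limsup A \<inter> ?S = limsup A" by blast
  ultimately have null: "limsup A \<in> null_sets sphere_measure"
    using emeasure_distr[OF idm, of "limsup A"]
    by (auto simp: null_sets_def \<mu>_def sets_restrict_space_iff Int_absorb2)
  show thesis
  proof (rule that)
    show "continuous_on UNIV (g n)" for n by (rule g)
    show "F\<^sub>0 \<subseteq> ?S - limsup A" using F0(2) \<open>limsup A \<subseteq> ?S - F\<^sub>0\<close> by blast
    show "?S - limsup A \<subseteq> ?S" by blast
    have "?S - (?S - limsup A) = limsup A" using \<open>limsup A \<subseteq> ?S - F\<^sub>0\<close> by blast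
    with null show "?S - (?S - limsup A) \<in> null_sets sphere_measure" by simp
    fix p assume p: "p \<in> ?S - limsup A"
    then obtain N where "\<And>n. N \<le> n \<Longrightarrow> p \<notin> A n" by (auto simp: limsup_INF_SUP)
    then have "g n p = \<psi> p" if "N \<le> n" for n using that p g(2)[of p n] by (auto simp: A_def)
    then show "(\<lambda>n. g n p) \<longlonglongrightarrow> \<psi> p"
      by (intro tendsto_eventually eventually_sequentiallyI[of N])
  qed
qed

section \<open>Density at boundary points\<close>

lemma emeasure_UN_geometric_le:
  assumes "\<And>i::nat. N i \<in> sets M" "0 \<le> c" "\<And>i. emeasure M (N i) \<le> ennreal ((1/2) ^ i * c)"
  shows "emeasure M (\<Union>i. N i) \<le> ennreal (2 * c)"
proof -
  have "emeasure M (\<Union>i. N i) \<le> (\<Sum>i. emeasure M (N i))"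
    using assms by (intro emeasure_subadditive_countably) auto
  also have "\<dots> \<le> (\<Sum>i. ennreal ((1/2) ^ i * c))" by (intro suminf_le assms) auto
  also have "\<dots> = ennreal (2 * c)"
    using assms(2) sums_mult2[OF geometric_sums[of "1/2::real"], of c] by (intro suminf_ennreal_eq) auto
  finally show ?thesis .
qed

text \<open>The intersection contains a ball of radius \<open>r / 2\<close>.\<close>
lemma measure_ball_Int_unit_ball_ge:
  fixes p :: "'a::euclidean_space"
  assumes p: "norm p = 1" and r: "0 < r" "r \<le> 1"
  shows "unit_ball_vol DIM('a) * (r/2) ^ DIM('a) \<le> measure lebesgue (ball p r \<inter> ball 0 1)"
proof -
  define q where "q = (1 - r/2) *\<^sub>R p"
  have nq: "norm q = 1 - r/2" using p r by (simp add: q_def)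
  have "p - q = (r/2) *\<^sub>R p" unfolding q_def by (simp add: algebra_simps)
  then have dpq: "dist p q = r/2" using p r by (simp add: dist_norm)
  have "ball q (r/2) \<subseteq> ball p r \<inter> ball 0 1"
  proof
    fix x assume "x \<in> ball q (r/2)"
    then show "x \<in> ball p r \<inter> ball 0 1"
      using dist_triangle[of p x q] dpq dist_triangle[of 0 x q] nq by simp
  qed
  then have "measure lebesgue (ball q (r/2)) \<le> measure lebesgue (ball p r \<inter> ball 0 1)"
    by (intro measure_mono_fmeasurable lmeasurable_open) (auto intro: bounded_subset[OF bounded_ball])
  then show ?thesis using content_ball[of "r/2" q] r by simp
qed

text \<open>
  A countable union of sets has density \<open>0\<close> at \<open>p\<close> as soon as each of them stays at some distance
  \<open>\<rho> i\<close> from \<open>p\<close> and is small compared with \<open>\<rho> i ^ DIM('a)\<close>: only the sets with \<open>\<rho> i < r\<close> meet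
  the ball of radius \<open>r\<close>, and their total measure is at most \<open>2 * r ^ Suc DIM('a)\<close>.
\<close>
lemma density_one_outside_union:
  fixes p :: "'a::euclidean_space"
  assumes p: "norm p = 1"
    and N: "\<And>i::nat. N i \<in> lmeasurable" "\<And>i. measure lebesgue (N i) \<le> (1/2) ^ i * \<rho> i ^ Suc DIM('a)"
    and \<rho>: "\<And>i. 0 \<le> \<rho> i" "\<And>i z. z \<in> N i \<Longrightarrow> \<rho> i \<le> dist p z"
  shows "((\<lambda>r. measure lebesgue (ball p r \<inter> (ball 0 1 - (\<Union>i. N i))) / measure lebesgue (ball p r \<inter> ball 0 1))
    \<longlongrightarrow> 1) (at_right 0)"
proof -
  define c where "c = unit_ball_vol DIM('a)"
  have c: "0 < c" by (simp add: c_def)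
  define V where "V r = measure lebesgue (ball p r \<inter> ball 0 1)" for r
  define W where "W r = measure lebesgue (ball p r \<inter> (ball 0 1 - (\<Union>i. N i)))" for r
  have bounds: "1 - 2 * 2 ^ DIM('a) / c * r \<le> W r / V r \<and> W r / V r \<le> 1" if r: "0 < r" "r < 1" for r
  proof -
    have Vc: "c * (r/2) ^ DIM('a) \<le> V r"
      unfolding V_def c_def using r by (intro measure_ball_Int_unit_ball_ge p) auto
    moreover have "0 < c * (r/2) ^ DIM('a)" using c r by simp
    ultimately have V: "0 < V r" by linarith
    define N' where "N' i = (if \<rho> i < r then N i else {})" for i
    have N': "N' i \<in> sets lebesgue" for i using N(1) by (auto simp: N'_def)
    have em: "emeasure lebesgue (\<Union>i. N' i) \<le> ennreal (2 * r ^ Suc DIM('a))"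
    proof (rule emeasure_UN_geometric_le)
      fix i
      have eq: "emeasure lebesgue (N' i) = ennreal (measure lebesgue (N' i))"
      proof (rule emeasure_eq_measure2)
        show "N' i \<in> lmeasurable" using N(1)[of i] by (simp add: N'_def)
      qed
      have "measure lebesgue (N' i) \<le> (1/2) ^ i * r ^ Suc DIM('a)"
      proof (cases "\<rho> i < r")
        case True
        then have "(1/2) ^ i * \<rho> i ^ Suc DIM('a) \<le> (1/2) ^ i * r ^ Suc DIM('a)"
          using \<rho>(1) by (intro mult_left_mono power_mono) auto
        then have "measure lebesgue (N i) \<le> (1/2) ^ i * r ^ Suc DIM('a)"
          using N(2)[of i] by (rule order_trans[rotated])
        with True show ?thesis by (simp add: N'_def)
      next
        case False
        then show ?thesis using r by (simp add: N'_def)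
      qed
      then show "emeasure lebesgue (N' i) \<le> ennreal ((1/2) ^ i * r ^ Suc DIM('a))"
        unfolding eq by (rule ennreal_leI)
    qed (use N' r in auto)
    then have fin: "(\<Union>i. N' i) \<in> lmeasurable"
      using N' by (intro fmeasurableI) (auto intro: le_less_trans)
    have mN: "measure lebesgue (\<Union>i. N' i) \<le> 2 * r ^ Suc DIM('a)"
      using em r by (simp add: measure_def enn2real_leI)
    have VW: "V r \<le> measure lebesgue (ball p r \<inter> (ball 0 1 - (\<Union>i. N i)) \<union> (\<Union>i. N' i))"
      unfolding V_def
    proof (rule measure_mono_fmeasurable)
      show "ball p r \<inter> ball 0 1 \<subseteq> ball p r \<inter> (ball 0 1 - (\<Union>i. N i)) \<union> (\<Union>i. N' i)"
      proof
        fix z assume z: "z \<in> ball p r \<inter> ball 0 1"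
        have "z \<in> N' i" if "z \<in> N i" for i using \<rho>(2)[OF that] z that by (auto simp: N'_def)
        with z show "z \<in> ball p r \<inter> (ball 0 1 - (\<Union>i. N i)) \<union> (\<Union>i. N' i)" by blast
      qed
      have "(\<Union>i. N i) \<in> sets lebesgue" using N(1) by blast
      then have "ball p r \<inter> (ball 0 1 - (\<Union>i. N i)) \<in> lmeasurable"
        by (intro fmeasurable_Int_fmeasurable) auto
      then show "ball p r \<inter> (ball 0 1 - (\<Union>i. N i)) \<union> (\<Union>i. N' i) \<in> lmeasurable"
        using fin by (rule fmeasurable.Un)
    qed auto
    also have "\<dots> \<le> W r + measure lebesgue (\<Union>i. N' i)"
    proof -
      have "(\<Union>i. N i) \<in> sets lebesgue" using N(1) by blast
      then show ?thesis unfolding W_def 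
        by (intro measure_Un_le sets.Int sets.Diff fmeasurableD[OF fin]) auto
    qed
    finally have low: "V r - 2 * r ^ Suc DIM('a) \<le> W r" using mN by simp
    have "W r \<le> V r" unfolding W_def V_def
    proof (rule measure_mono_fmeasurable)
      have "(\<Union>i. N i) \<in> sets lebesgue" using N(1) by blast
      then show "ball p r \<inter> (ball 0 1 - (\<Union>i. N i)) \<in> sets lebesgue"
        by (intro sets.Int sets.Diff) auto
    qed auto
    then have "W r / V r \<le> 1" using V by simp
    moreover have "2 * r ^ Suc DIM('a) \<le> 2 * 2 ^ DIM('a) / c * r * V r"
    proof -
      have "2 * r ^ Suc DIM('a) = 2 * 2 ^ DIM('a) / c * r * (c * (r/2) ^ DIM('a))"
        using c by (simp add: power_divide)
      also have "\<dots> \<le> 2 * 2 ^ DIM('a) / c * r * V r"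
        using Vc c r by (intro mult_left_mono) auto
      finally show ?thesis .
    qed
    then have "(1 - 2 * 2 ^ DIM('a) / c * r) * V r \<le> W r" using low by (simp add: left_diff_distrib)
    then have "1 - 2 * 2 ^ DIM('a) / c * r \<le> W r / V r" using V by (simp add: pos_le_divide_eq)
    ultimately show ?thesis by blast
  qed
  have ev: "\<forall>\<^sub>F r in at_right (0::real). 0 < r \<and> r < 1"
    using eventually_at_right_less[of 0] eventually_at_right[of 0 1] by (intro eventually_conj) (auto intro: eventually_at_rightI[of 0 1])
  have "((\<lambda>r. 1 - 2 * 2 ^ DIM('a) / c * r) \<longlongrightarrow> 1 - 2 * 2 ^ DIM('a) / c * 0) (at_right 0)"
    by (intro tendsto_intros)
  then have lim: "((\<lambda>r. 1 - 2 * 2 ^ DIM('a) / c * r) \<longlongrightarrow> 1) (at_right 0)" by simp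
  have "((\<lambda>r. W r / V r) \<longlongrightarrow> 1) (at_right 0)"
  proof (rule tendsto_sandwich[OF _ _ lim tendsto_const])
    show "\<forall>\<^sub>F r in at_right 0. 1 - 2 * 2 ^ DIM('a) / c * r \<le> W r / V r"
      "\<forall>\<^sub>F r in at_right 0. W r / V r \<le> 1"
      using ev bounds by (auto elim: eventually_mono)
  qed
  then show ?thesis by (simp add: W_def V_def)
qed

lemma outer_shell_measure_small:
  assumes "0 < \<theta>"
  obtains \<rho>\<^sub>0 where "\<rho>\<^sub>0 < 1"
    "\<And>\<rho>. \<rho>\<^sub>0 \<le> \<rho> \<Longrightarrow> 0 \<le> \<rho> \<Longrightarrow> \<rho> < 1 \<Longrightarrow> measure lebesgue (ball (0::'a::euclidean_space) 1 - ball 0 \<rho>) \<le> \<theta>"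
proof -
  define c where "c = unit_ball_vol DIM('a)"
  have m: "measure lebesgue (ball (0::'a) 1 - ball 0 \<rho>) = c - c * \<rho> ^ DIM('a)"
    if "0 \<le> \<rho>" "\<rho> < 1" for \<rho>
  proof -
    have "measure lebesgue (ball (0::'a) 1 - ball 0 \<rho>) = measure lebesgue (ball (0::'a) 1) - measure lebesgue (ball (0::'a) \<rho>)"
      using that by (intro measurable_measure_Diff) auto
    then show ?thesis
      using that content_ball[of 1 "0::'a"] content_ball[of \<rho> "0::'a"] by (simp add: c_def)
  qed
  have "((\<lambda>\<rho>. c - c * \<rho> ^ DIM('a)) \<longlongrightarrow> c - c * 1 ^ DIM('a)) (at_left 1)"
    by (intro tendsto_intros)
  then have "\<forall>\<^sub>F \<rho> in at_left 1. c - c * \<rho> ^ DIM('a) < \<theta>"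
    by (rule order_tendstoD) (use assms in simp)
  then obtain b where b: "b < 1" "\<And>\<rho>. b < \<rho> \<Longrightarrow> \<rho> < 1 \<Longrightarrow> c - c * \<rho> ^ DIM('a) < \<theta>"
    unfolding eventually_at_left_field by blast
  show thesis
  proof (rule that)
    show "(b + 1) / 2 < 1" using b(1) by simp
    fix \<rho> assume "(b + 1) / 2 \<le> \<rho>" "0 \<le> \<rho>" "\<rho> < 1"
    then show "measure lebesgue (ball (0::'a) 1 - ball 0 \<rho>) \<le> \<theta>"
      using b m[of \<rho>] by (simp add: less_imp_le)
  qed
qed

section \<open>The limit function\<close>

lemma shell_sequence:
  fixes g :: "nat \<Rightarrow> complex ^ 'n \<Rightarrow> complex"
  assumes \<rho>: "\<And>k. 0 < \<rho> k" "\<And>k. \<rho> k < \<rho> (Suc k)" "\<And>k. \<rho> k < 1" and \<theta>: "\<And>k. 0 < \<theta> k"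
  obtains f E where "\<And>k. bounded_holo (f k)" "\<And>k. E k \<in> lmeasurable" "\<And>k. measure lebesgue (E k) \<le> \<theta> k"
    "\<And>k z. norm z \<le> \<rho> k \<Longrightarrow> norm (f (Suc k) z - f k z) \<le> (1/2) ^ k"
    "\<And>k z. z \<in> ball 0 1 - E k \<Longrightarrow> (norm z < \<rho> (Suc k) \<and> norm (f (Suc k) z - f k z) \<le> (1/2) ^ k) \<or>
      (\<exists>u. norm u = 1 \<and> norm (z - u) \<le> sqrt (2 * (1 - \<rho> k)) \<and> norm (f (Suc k) z - g k u) \<le> (1/2) ^ k)"
proof -
  let ?Q = "\<lambda>k x y. snd y \<in> lmeasurable \<and> measure lebesgue (snd y) \<le> \<theta> k \<and>
    (\<forall>z. norm z \<le> \<rho> k \<longrightarrow> norm (fst y z - fst x z) \<le> (1/2) ^ k) \<and>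
    (\<forall>z\<in>ball 0 1 - snd y. (norm z < \<rho> (Suc k) \<and> norm (fst y z - fst x z) \<le> (1/2) ^ k) \<or>
      (\<exists>u. norm u = 1 \<and> norm (z - u) \<le> sqrt (2 * (1 - \<rho> k)) \<and> norm (fst y z - g k u) \<le> (1/2) ^ k))"
  have "\<exists>s. \<forall>k. bounded_holo (fst (s k)) \<and> ?Q k (s k) (s (Suc k))"
  proof (rule dependent_nat_choice)
    show "\<exists>x. bounded_holo (fst x)" using bounded_holo_const by (metis fst_conv)
    fix x :: "(complex ^ 'n \<Rightarrow> complex) \<times> (complex ^ 'n) set" and k
    assume "bounded_holo (fst x)"
    from shell_step[OF this \<rho>(1)[of k] \<rho>(2)[of k] \<rho>(3)[of "Suc k"], of "(1/2) ^ k" "\<theta> k" "g k"] \<theta>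
    obtain f E where "bounded_holo f" "E \<in> lmeasurable" "measure lebesgue E \<le> \<theta> k"
      "\<forall>z. norm z \<le> \<rho> k \<longrightarrow> norm (f z - fst x z) \<le> (1/2) ^ k"
      "\<forall>z\<in>ball 0 1 - E. (norm z < \<rho> (Suc k) \<and> norm (f z - fst x z) \<le> (1/2) ^ k) \<or>
        (\<exists>u. norm u = 1 \<and> norm (z - u) \<le> sqrt (2 * (1 - \<rho> k)) \<and> norm (f z - g k u) \<le> (1/2) ^ k)"
      by auto
    then show "\<exists>y. bounded_holo (fst y) \<and> ?Q k x y" by (intro exI[of _ "(f, E)"]) simp
  qed
  then obtain s where s: "\<And>k. bounded_holo (fst (s k))" "\<And>k. ?Q k (s k) (s (Suc k))" by blast
  show thesis
    by (rule that[of "\<lambda>k. fst (s k)" "\<lambda>k. snd (s (Suc k))"]) (use s in blast)+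
qed

lemma limit_of_shell_sequence:
  fixes f :: "nat \<Rightarrow> complex ^ 'n \<Rightarrow> complex"
  assumes \<rho>: "mono \<rho>" "\<rho> \<longlonglongrightarrow> 1"
    and f: "\<And>k. holomorphic_on_cn (f k) (ball 0 1)"
      "\<And>k z. norm z \<le> \<rho> k \<Longrightarrow> norm (f (Suc k) z - f k z) \<le> (1/2) ^ k"
  obtains F where "holomorphic_on_cn F (ball 0 1)"
    "\<And>k z. norm z \<le> \<rho> k \<Longrightarrow> norm (F z - f k z) \<le> 2 * (1/2) ^ k"
proof -
  have tail: "norm (f (k + n) z - f k z) \<le> 2 * (1/2) ^ k - 2 * (1/2) ^ (k + n)"
    if z: "norm z \<le> \<rho> k" for k n z
  proof (induction n)
    case 0
    show ?case by simp
  next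
    case (Suc n)
    have "norm z \<le> \<rho> (k + n)" using z monoD[OF \<rho>(1), of k "k + n"] by simp
    then have "norm (f (Suc (k + n)) z - f (k + n) z) \<le> (1/2) ^ (k + n)" by (rule f(2))
    then show ?case
      using Suc norm_triangle_ineq[of "f (Suc (k + n)) z - f (k + n) z" "f (k + n) z - f k z"] by simp
  qed
  have small: "\<exists>K. (\<forall>k\<ge>K. 2 * (1/2) ^ k < e)" if "0 < e" for e :: real
  proof -
    have "(\<lambda>k. 2 * (1/2::real) ^ k) \<longlonglongrightarrow> 2 * 0" by (intro tendsto_intros LIMSEQ_realpow_zero) auto
    then have "\<forall>\<^sub>F k in sequentially. 2 * (1/2::real) ^ k < e"
      using that by (intro order_tendstoD) auto
    then show ?thesis by (simp add: eventually_sequentially)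
  qed
  define F where "F z = lim (\<lambda>k. f k z)" for z
  have lim: "(\<lambda>k. f k z) \<longlonglongrightarrow> F z" if z: "norm z \<le> \<rho> k" for k z
  proof -
    have "Cauchy (\<lambda>m. f m z)"
    proof (rule CauchyI')
      fix e :: real assume "0 < e"
      then obtain K where K: "\<And>m. K \<le> m \<Longrightarrow> 2 * (1/2) ^ m < e" using small by blast
      show "\<exists>M. \<forall>m\<ge>M. \<forall>n>m. dist (f m z) (f n z) < e"
      proof (intro exI[of _ "max k K"] allI impI)
        fix m n assume mn: "max k K \<le> m" "m < n"
        then have "norm z \<le> \<rho> m" using z monoD[OF \<rho>(1), of k m] by simp
        from tail[OF this, of "n - m"] mn have "norm (f n z - f m z) \<le> 2 * (1/2) ^ m - 2 * (1/2) ^ n" by simp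
        also have "\<dots> < e" using K[of m] mn by (smt (verit) max.bounded_iff zero_less_power half_gt_zero)
        finally show "dist (f m z) (f n z) < e" by (simp add: dist_norm norm_minus_commute)
      qed
    qed
    then show ?thesis unfolding F_def by (simp add: Cauchy_convergent convergent_LIMSEQ_iff[symmetric])
  qed
  have bound: "norm (F z - f k z) \<le> 2 * (1/2) ^ k" if z: "norm z \<le> \<rho> k" for k z
  proof (rule Lim_bounded)
    show "(\<lambda>m. norm (f m z - f k z)) \<longlonglongrightarrow> norm (F z - f k z)" by (intro tendsto_intros lim[OF z])
    show "\<forall>m\<ge>k. norm (f m z - f k z) \<le> 2 * (1/2) ^ k"
    proof (intro allI impI)
      fix m assume "k \<le> m"
      with tail[OF z, of "m - k"] have "norm (f m z - f k z) \<le> 2 * (1/2) ^ k - 2 * (1/2) ^ m" by simp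
      also have "\<dots> \<le> 2 * (1/2) ^ k" by simp
      finally show "norm (f m z - f k z) \<le> 2 * (1/2) ^ k" .
    qed
  qed
  have "holomorphic_on_cn F (ball 0 1)"
  proof (rule holomorphic_on_cn_uniform_limit[OF f(1)])
    fix r :: real assume "r < 1"
    then have "\<forall>\<^sub>F k in sequentially. r < \<rho> k" using \<rho>(2) by (intro order_tendstoD)
    then obtain k0 where k0: "\<And>k. k0 \<le> k \<Longrightarrow> r < \<rho> k" by (auto simp: eventually_sequentially)
    show "uniform_limit (ball 0 r) f F sequentially"
    proof (rule uniform_limitI)
      fix e :: real assume "0 < e"
      then obtain K where K: "\<And>m. K \<le> m \<Longrightarrow> 2 * (1/2) ^ m < e" using small by blast
      show "\<forall>\<^sub>F n in sequentially. \<forall>x\<in>ball 0 r. dist (f n x) (F x) < e"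
      proof (rule eventually_sequentiallyI[of "max k0 K"], intro ballI)
        fix n and x :: "complex ^ 'n" assume "max k0 K \<le> n" "x \<in> ball 0 r"
        then have "norm x \<le> \<rho> n" "2 * (1/2) ^ n < e" using k0[of n] K[of n] by auto
        with bound[of x n] show "dist (f n x) (F x) < e" by (simp add: dist_norm norm_minus_commute)
      qed
    qed
  qed
  then show thesis using bound by (rule that)
qed

lemma fast_increasing_radii:
  fixes \<tau> :: "nat \<Rightarrow> real"
  assumes "\<And>k. \<tau> k < 1"
  obtains \<rho> where "\<And>k. 0 < \<rho> k" "\<And>k. \<rho> k < \<rho> (Suc k)" "\<And>k. \<rho> k < 1" "\<And>k. \<tau> k \<le> \<rho> k" "\<rho> \<longlonglongrightarrow> 1"
proof -
  have "\<exists>\<rho>. \<forall>k. (0 < \<rho> k \<and> \<rho> k < 1 \<and> \<tau> k \<le> \<rho> k \<and> 1 - inverse (real (Suc k)) \<le> \<rho> k) \<and> \<rho> k < \<rho> (Suc k)"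
  proof (rule dependent_nat_choice)
    show "\<exists>x. 0 < x \<and> x < 1 \<and> \<tau> 0 \<le> x \<and> 1 - inverse (real (Suc 0)) \<le> x"
      using assms[of 0] by (intro exI[of _ "max (1/2) (\<tau> 0)"]) auto
    fix x :: real and k
    assume "0 < x \<and> x < 1 \<and> \<tau> k \<le> x \<and> 1 - inverse (real (Suc k)) \<le> x"
    then show "\<exists>y. (0 < y \<and> y < 1 \<and> \<tau> (Suc k) \<le> y \<and> 1 - inverse (real (Suc (Suc k))) \<le> y) \<and> x < y"
      using assms[of "Suc k"]
      by (intro exI[of _ "max ((1 + x) / 2) (max (\<tau> (Suc k)) (1 - inverse (real (Suc (Suc k)))))"])
        (auto simp: less_max_iff_disj)
  qed
  then obtain \<rho> where \<rho>: "\<And>k. 0 < \<rho> k" "\<And>k. \<rho> k < 1" "\<And>k. \<tau> k \<le> \<rho> k" "\<And>k. \<rho> k < \<rho> (Suc k)"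
    "\<And>k. 1 - inverse (real (Suc k)) \<le> \<rho> k" by blast
  have "\<rho> \<longlonglongrightarrow> 1"
  proof (rule tendsto_sandwich)
    show "(\<lambda>k. 1 - inverse (real (Suc k))) \<longlonglongrightarrow> 1"
      using tendsto_diff[OF tendsto_const[of 1] LIMSEQ_inverse_real_of_nat] by simp
    show "\<forall>\<^sub>F k in sequentially. 1 - inverse (real (Suc k)) \<le> \<rho> k" using \<rho>(5) by simp
    show "\<forall>\<^sub>F k in sequentially. \<rho> k \<le> 1" using \<rho>(2) by (simp add: less_imp_le)
  qed (rule tendsto_const)
  with \<rho> show thesis by (intro that)
qed

text \<open>
  The analytic core: for any sequence of continuous functions on the sphere there is one
  holomorphic function that has, at every point where the sequence converges, the same limit
  along a set of density one.
\<close>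
theorem holomorphic_with_boundary_limits:
  fixes g :: "nat \<Rightarrow> complex ^ 'n \<Rightarrow> complex"
  assumes g: "\<And>k. continuous_on (sphere 0 1) (g k)"
  obtains f where "holomorphic_on_cn f (ball 0 1)"
    "\<And>p l. norm p = 1 \<Longrightarrow> (\<lambda>k. g k p) \<longlonglongrightarrow> l \<Longrightarrow>
      \<exists>A. A \<subseteq> ball 0 1 \<and> A \<in> sets lebesgue \<and> (f \<longlongrightarrow> l) (at p within A) \<and>
       ((\<lambda>r. measure lebesgue (ball p r \<inter> A) / measure lebesgue (ball p r \<inter> ball 0 1)) \<longlongrightarrow> 1) (at_right 0)"
proof -
  let ?d = "DIM(complex ^ 'n)"
  have "\<exists>\<delta>>0. \<forall>x y. norm x = 1 \<longrightarrow> norm y = 1 \<longrightarrow> dist x y < \<delta> \<longrightarrow> dist (g k x) (g k y) < (1/2) ^ k" for k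
  proof -
    have "uniformly_continuous_on (sphere 0 1) (g k)"
      by (rule compact_uniformly_continuous[OF g compact_sphere])
    then have "\<exists>\<delta>>0. \<forall>x\<in>sphere 0 1. \<forall>y\<in>sphere 0 1. dist y x < \<delta> \<longrightarrow> dist (g k y) (g k x) < (1/2) ^ k"
      unfolding uniformly_continuous_on_def by (rule allE[of _ "(1/2) ^ k"]) simp
    then show ?thesis by auto
  qed
  then obtain \<delta> where \<delta>: "\<And>k. 0 < \<delta> k"
    "\<And>k x y. norm x = 1 \<Longrightarrow> norm y = 1 \<Longrightarrow> dist x y < \<delta> k \<Longrightarrow> dist (g k x) (g k y) < (1/2) ^ k" by metis
  have "\<exists>\<tau><1. \<forall>\<rho>. \<tau> \<le> \<rho> \<longrightarrow> 0 \<le> \<rho> \<longrightarrow> \<rho> < 1 \<longrightarrow>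
      measure lebesgue (ball (0 :: complex ^ 'n) 1 - ball 0 \<rho>) \<le> (1/2) ^ (2 * k + 1) * (\<delta> k / 2) ^ Suc ?d \<and>
      sqrt (2 * (1 - \<rho>)) \<le> \<delta> k / 2" for k
  proof -
    have "0 < (1/2) ^ (2 * k + 1) * (\<delta> k / 2) ^ Suc ?d" using \<delta>(1) by simp
    then obtain \<rho>0 where \<rho>0: "\<rho>0 < 1" "\<And>\<rho>. \<rho>0 \<le> \<rho> \<Longrightarrow> 0 \<le> \<rho> \<Longrightarrow> \<rho> < 1 \<Longrightarrow>
        measure lebesgue (ball (0 :: complex ^ 'n) 1 - ball 0 \<rho>) \<le> (1/2) ^ (2 * k + 1) * (\<delta> k / 2) ^ Suc ?d"
      using outer_shell_measure_small[OF \<open>0 < (1/2) ^ (2 * k + 1) * (\<delta> k / 2) ^ Suc ?d\<close>] by blast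
    have "sqrt (2 * (1 - \<rho>)) \<le> \<delta> k / 2" if "1 - (\<delta> k / 2) ^ 2 / 2 \<le> \<rho>" for \<rho>
      using that \<delta>(1)[of k] by (intro real_le_lsqrt) auto
    then show ?thesis using \<rho>0 \<delta>(1)[of k]
      by (intro exI[of _ "max \<rho>0 (1 - (\<delta> k / 2) ^ 2 / 2)"]) auto
  qed
  then obtain \<tau> where \<tau>: "\<And>k. \<tau> k < 1" "\<And>k \<rho>. \<tau> k \<le> \<rho> \<Longrightarrow> 0 \<le> \<rho> \<Longrightarrow> \<rho> < 1 \<Longrightarrow>
      measure lebesgue (ball (0 :: complex ^ 'n) 1 - ball 0 \<rho>) \<le> (1/2) ^ (2 * k + 1) * (\<delta> k / 2) ^ Suc ?d"
     "\<And>k \<rho>. \<tau> k \<le> \<rho> \<Longrightarrow> 0 \<le> \<rho> \<Longrightarrow> \<rho> < 1 \<Longrightarrow> sqrt (2 * (1 - \<rho>)) \<le> \<delta> k / 2"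
    by metis
  \<comment> \<open>The radii tend to 1 so fast that the shell on which \<open>g k\<close> is used is thin compared with the
      scale \<open>\<delta> k\<close> on which \<open>g k\<close> is nearly constant.\<close>
  obtain \<rho> where \<rho>: "\<And>k. 0 < \<rho> k" "\<And>k. \<rho> k < \<rho> (Suc k)" "\<And>k. \<rho> k < 1" "\<And>k. \<tau> k \<le> \<rho> k" "\<rho> \<longlonglongrightarrow> 1"
    by (rule fast_increasing_radii[of \<tau>, OF \<tau>(1)]) (rule that)
  have mono: "mono \<rho>" using \<rho>(2) by (intro incseq_SucI less_imp_le)
  have shell: "measure lebesgue (ball (0 :: complex ^ 'n) 1 - ball 0 (\<rho> k)) \<le> (1/2) ^ (2 * k + 1) * (\<delta> k / 2) ^ Suc ?d"
    and sq: "sqrt (2 * (1 - \<rho> k)) \<le> \<delta> k / 2" for k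
    using \<tau>(2,3)[OF \<rho>(4)] \<rho>(1,3)[of k] by (auto intro: less_imp_le)
  define \<theta> where "\<theta> k = (1/2) ^ (2 * k + 1) * (1 - \<rho> (Suc (Suc k))) ^ Suc ?d" for k
  have \<theta>: "0 < \<theta> k" for k using \<rho>(3) by (simp add: \<theta>_def)
  obtain f E where f: "\<And>k. bounded_holo (f k)"
    "\<And>k z. norm z \<le> \<rho> k \<Longrightarrow> norm (f (Suc k) z - f k z) \<le> (1/2) ^ k"
    and E: "\<And>k. E k \<in> lmeasurable" "\<And>k. measure lebesgue (E k) \<le> \<theta> k"
    "\<And>k z. z \<in> ball 0 1 - E k \<Longrightarrow> (norm z < \<rho> (Suc k) \<and> norm (f (Suc k) z - f k z) \<le> (1/2) ^ k) \<or>
      (\<exists>u. norm u = 1 \<and> norm (z - u) \<le> sqrt (2 * (1 - \<rho> k)) \<and> norm (f (Suc k) z - g k u) \<le> (1/2) ^ k)"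
    by (rule shell_sequence[of \<rho> \<theta> g, OF \<rho>(1) \<rho>(2) \<rho>(3) \<theta>]) (rule that)
  have hol: "holomorphic_on_cn (f k) (ball 0 1)" for k using f(1) by (simp add: bounded_holo_def)
  obtain F where F: "holomorphic_on_cn F (ball 0 1)"
    "\<And>k z. norm z \<le> \<rho> k \<Longrightarrow> norm (F z - f k z) \<le> 2 * (1/2) ^ k"
    by (rule limit_of_shell_sequence[of \<rho> f, OF mono \<rho>(5) hol f(2)], assumption) (rule that)
  \<comment> \<open>Slabs of stage \<open>k\<close> matter only up to radius \<open>\<rho> (k + 2)\<close>, since at larger radii the caps of
      stage \<open>k + 1\<close> prescribe the values anew. So \<open>X k\<close> keeps a positive distance from the
      sphere.\<close>
  define X where "X k = E k \<inter> ball 0 (\<rho> (Suc (Suc k)))" for k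
  \<comment> \<open>Stage \<open>k\<close> assigns a value to every point of this shell outside the slabs; stage \<open>k + 1\<close> keeps
      it or replaces it by one of its own.\<close>
  have near: "\<exists>i\<in>{k, Suc k}. \<exists>u. norm u = 1 \<and> norm (z - u) \<le> \<delta> i / 2 \<and> norm (F z - g i u) \<le> 2 * (1/2) ^ k"
    if z: "\<rho> (Suc k) \<le> norm z" "norm z < \<rho> (Suc (Suc k))" "z \<notin> X k" "z \<notin> X (Suc k)" for k z
  proof -
    have b: "z \<in> ball 0 1" using z(2) \<rho>(3)[of "Suc (Suc k)"] by simp
    have "norm z < \<rho> (Suc (Suc (Suc k)))" using z(2) \<rho>(2)[of "Suc (Suc k)"] by simp
    with z b have "z \<in> ball 0 1 - E k" "z \<in> ball 0 1 - E (Suc k)" by (auto simp: X_def)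
    note 1 = E(3)[OF this(1)] and 2 = E(3)[OF this(2)]
    have 3: "norm (F z - f (Suc (Suc k)) z) \<le> (1/2) ^ k / 2" using F(2)[of z "Suc (Suc k)"] z(2) by simp
    from 2 consider (keep) "norm (f (Suc (Suc k)) z - f (Suc k) z) \<le> (1/2) ^ k / 2"
      | (new) u where "norm u = 1" "norm (z - u) \<le> \<delta> (Suc k) / 2" "norm (f (Suc (Suc k)) z - g (Suc k) u) \<le> (1/2) ^ k / 2"
      using order_trans[OF _ sq[of "Suc k"]] by auto
    then show ?thesis
    proof cases
      case keep
      from 1 z(1) obtain u where u: "norm u = 1" "norm (z - u) \<le> \<delta> k / 2" "norm (f (Suc k) z - g k u) \<le> (1/2) ^ k"
        using order_trans[OF _ sq[of k]] by auto
      have "F z - g k u = (F z - f (Suc (Suc k)) z) + (f (Suc (Suc k)) z - f (Suc k) z) + (f (Suc k) z - g k u)"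
        by simp
      also have "norm \<dots> \<le> (1/2) ^ k / 2 + (1/2) ^ k / 2 + (1/2) ^ k"
        using 3 keep u(3) by (intro order_trans[OF norm_triangle_ineq] add_mono)
      finally show ?thesis using u by auto
    next
      case new
      have "F z - g (Suc k) u = (F z - f (Suc (Suc k)) z) + (f (Suc (Suc k)) z - g (Suc k) u)" by simp
      also have "norm \<dots> \<le> (1/2) ^ k / 2 + (1/2) ^ k / 2"
        using 3 new(3) by (intro order_trans[OF norm_triangle_ineq] add_mono)
      also have "\<dots> \<le> 2 * (1/2) ^ k" by simp
      finally show ?thesis using new by auto
    qed
  qed
  show thesis
  proof (rule that[OF F(1)])
    fix p :: "complex ^ 'n" and l assume p: "norm p = 1" and l: "(\<lambda>k. g k p) \<longlonglongrightarrow> l"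
    \<comment> \<open>\<open>Y k\<close> collects the points that may receive values of \<open>g k\<close> but are too far from \<open>p\<close> for these
        values to be close to \<open>g k p\<close>.\<close>
    define Y where "Y k = ball 0 1 - ball 0 (\<rho> k) - ball p (\<delta> k / 2)" for k
    \<comment> \<open>The two families are interleaved into one sequence.\<close>
    define N where "N n = (if even n then X (n div 2) else Y (n div 2))" for n
    define r where "r n = (if even n then 1 - \<rho> (Suc (Suc (n div 2))) else \<delta> (n div 2) / 2)" for n
    have pow: "(1/2::real) ^ (2 * (n div 2) + 1) \<le> (1/2) ^ n" for n
      by (rule power_decreasing) auto
    have X: "X k \<in> lmeasurable" "measure lebesgue (X k) \<le> \<theta> k" for k
    proof -
      show "X k \<in> lmeasurable" unfolding X_def using E(1) by (intro fmeasurable.Int) auto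
      have "measure lebesgue (X k) \<le> measure lebesgue (E k)"
        using E(1) \<open>X k \<in> lmeasurable\<close> by (intro measure_mono_fmeasurable) (auto simp: X_def fmeasurableD)
      then show "measure lebesgue (X k) \<le> \<theta> k" using E(2)[of k] by simp
    qed
    have Y: "Y k \<in> lmeasurable" "measure lebesgue (Y k) \<le> (1/2) ^ (2 * k + 1) * (\<delta> k / 2) ^ Suc ?d" for k
    proof -
      have shell': "ball (0 :: complex ^ 'n) 1 - ball 0 (\<rho> k) \<in> lmeasurable"
        by (intro fmeasurable.Diff) auto
      then show "Y k \<in> lmeasurable" unfolding Y_def by (intro fmeasurable.Diff) auto
      then have "measure lebesgue (Y k) \<le> measure lebesgue (ball (0 :: complex ^ 'n) 1 - ball 0 (\<rho> k))"
        using shell'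
        by (intro measure_mono_fmeasurable) (auto simp: Y_def fmeasurableD)
      with shell show "measure lebesgue (Y k) \<le> (1/2) ^ (2 * k + 1) * (\<delta> k / 2) ^ Suc ?d"
        by (rule order_trans[rotated])
    qed
    have dens: "((\<lambda>r. measure lebesgue (ball p r \<inter> (ball 0 1 - (\<Union>n. N n))) / measure lebesgue (ball p r \<inter> ball 0 1))
        \<longlongrightarrow> 1) (at_right 0)"
    proof (rule density_one_outside_union[OF p])
      show "N n \<in> lmeasurable" for n using X Y by (simp add: N_def)
      show r0: "0 \<le> r n" for n using \<rho>(3) \<delta>(1) by (simp add: r_def less_imp_le)
      show "measure lebesgue (N n) \<le> (1/2) ^ n * r n ^ Suc ?d" for n
      proof -
        have "measure lebesgue (N n) \<le> (1/2) ^ (2 * (n div 2) + 1) * r n ^ Suc ?d"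
          using X(2)[of "n div 2"] Y(2)[of "n div 2"] by (simp only: N_def r_def \<theta>_def split: if_split) blast
        also have "\<dots> \<le> (1/2) ^ n * r n ^ Suc ?d" using r0 by (intro mult_right_mono pow zero_le_power)
        finally show ?thesis .
      qed
      show "r n \<le> dist p z" if "z \<in> N n" for n z
      proof (cases "even n")
        case True
        then have "norm z < \<rho> (Suc (Suc (n div 2)))" using that by (simp add: N_def X_def)
        then show ?thesis using True norm_triangle_ineq2[of p z] p by (simp add: r_def dist_norm)
      next
        case False
        then show ?thesis using that by (simp add: N_def Y_def r_def)
      qed
    qed
    define A where "A = ball 0 1 - (\<Union>n. N n)"
    have NX: "X k \<subseteq> (\<Union>n. N n)" and NY: "Y k \<subseteq> (\<Union>n. N n)" for k
    proof -
      have "N (2 * k) = X k" "N (2 * k + 1) = Y k" by (simp_all add: N_def)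
      then show "X k \<subseteq> (\<Union>n. N n)" "Y k \<subseteq> (\<Union>n. N n)" by blast+
    qed
    have "(F \<longlongrightarrow> l) (at p within A)"
    proof (rule tendstoI)
      fix e :: real assume e: "0 < e"
      have "\<forall>\<^sub>F k in sequentially. dist (g k p) l < e / 2" using l e by (intro tendstoD) auto
      moreover have "(\<lambda>k. 3 * (1/2::real) ^ k) \<longlonglongrightarrow> 3 * 0" by (intro tendsto_intros LIMSEQ_realpow_zero) auto
      then have "\<forall>\<^sub>F k in sequentially. 3 * (1/2::real) ^ k < e / 2"
        by (rule order_tendstoD) (use e in simp)
      ultimately have "\<forall>\<^sub>F k in sequentially. dist (g k p) l < e / 2 \<and> 3 * (1/2::real) ^ k < e / 2"
        by (rule eventually_conj)
      then obtain K where K: "\<And>k. K \<le> k \<Longrightarrow> dist (g k p) l < e / 2" "\<And>k. K \<le> k \<Longrightarrow> 3 * (1/2::real) ^ k < e / 2"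
        by (auto simp: eventually_sequentially)
      have "dist (F z) l < e" if z: "z \<in> A" and d: "dist z p < 1 - \<rho> (Suc K)" for z
      proof -
        have "norm z < 1" using z by (simp add: A_def)
        then have "\<forall>\<^sub>F k in sequentially. norm z < \<rho> k" using \<rho>(5) by (intro order_tendstoD)
        then have ex: "\<exists>m. norm z < \<rho> m" by (auto simp: eventually_sequentially)
        define m where "m = (LEAST m. norm z < \<rho> m)"
        have m: "norm z < \<rho> m" unfolding m_def by (rule LeastI_ex[OF ex])
        have "\<rho> (Suc K) < norm z"
          using d norm_triangle_ineq2[of p z] p by (simp add: dist_norm norm_minus_commute)
        then have "\<not> m \<le> Suc K" using m monoD[OF mono, of m "Suc K"] by auto
        then obtain k where k: "m = Suc (Suc k)" "K \<le> k" by (metis Suc_le_D not_less_eq_eq Suc_le_mono)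
        have lo: "\<rho> (Suc k) \<le> norm z" using not_less_Least[of "Suc k" "\<lambda>m. norm z < \<rho> m"] k by (simp add: m_def[symmetric])
        have "z \<notin> X k" "z \<notin> X (Suc k)" using z NX by (auto simp: A_def)
        from near[OF lo _ this] m k obtain i u where i: "i = k \<or> i = Suc k" and u: "norm u = 1" "norm (z - u) \<le> \<delta> i / 2"
          "norm (F z - g i u) \<le> 2 * (1/2) ^ k" by auto
        have "\<rho> i \<le> norm z" using lo monoD[OF mono, of i "Suc k"] i by auto
        moreover have "z \<notin> Y i" using z NY by (auto simp: A_def)
        ultimately have "dist p z < \<delta> i / 2" using \<open>norm z < 1\<close> by (auto simp: Y_def)
        then have "dist u p < \<delta> i" using u(2) dist_triangle[of u p z] by (simp add: dist_norm norm_minus_commute)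
        then have "dist (g i u) (g i p) < (1/2) ^ i" using \<delta>(2) u(1) p by blast
        also have "\<dots> \<le> (1/2) ^ k" using i by (intro power_decreasing) auto
        finally have "dist (F z) (g i p) < 3 * (1/2) ^ k"
          using u(3) dist_triangle[of "F z" "g i p" "g i u"] by (simp add: dist_norm)
        then show ?thesis
          using K(1)[of i] K(2)[of k] i k dist_triangle[of "F z" l "g i p"] by auto
      qed
      then show "\<forall>\<^sub>F z in at p within A. dist (F z) l < e"
        unfolding eventually_at using \<rho>(3)[of "Suc K"] by (intro exI[of _ "1 - \<rho> (Suc K)"]) auto
    qed
    moreover have "A \<in> sets lebesgue"
    proof -
      have "N n \<in> sets lebesgue" for n using X Y by (simp add: N_def fmeasurableD)
      then show ?thesis unfolding A_def by (intro sets.Diff sets.countable_UN) auto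
    qed
    moreover have "A \<subseteq> ball 0 1" by (auto simp: A_def)
    ultimately show "\<exists>A. A \<subseteq> ball 0 1 \<and> A \<in> sets lebesgue \<and> (F \<longlongrightarrow> l) (at p within A) \<and>
       ((\<lambda>r. measure lebesgue (ball p r \<inter> A) / measure lebesgue (ball p r \<inter> ball 0 1)) \<longlongrightarrow> 1) (at_right 0)"
      using dens unfolding A_def by blast
  qed
qed

theorem theorem1:
  fixes \<psi> :: "complex ^ 'n \<Rightarrow> complex" and F\<^sub>0 :: "(complex ^ 'n) set"
  assumes "\<psi> \<in> borel_measurable (restrict_space borel (sphere 0 1))"
    and "closed F\<^sub>0" and "F\<^sub>0 \<subseteq> sphere 0 1"
    and "continuous_on F\<^sub>0 \<psi>"
  shows "\<exists>(f :: complex ^ 'n \<Rightarrow> complex) F.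
    holomorphic_on_cn f (ball 0 1) \<and>
    F\<^sub>0 \<subseteq> F \<and> F \<subseteq> sphere 0 1 \<and> sphere 0 1 - F \<in> null_sets sphere_measure \<and>
    (\<forall>p\<in>F. \<exists>A. A \<subseteq> ball 0 1 \<and> A \<in> sets lebesgue \<and>
       (f \<longlongrightarrow> \<psi> p) (at p within A) \<and>
       ((\<lambda>r. measure lebesgue (ball p r \<inter> A) / measure lebesgue (ball p r \<inter> ball 0 1))
          \<longlongrightarrow> 1) (at_right 0))"
proof -
  obtain g :: "nat \<Rightarrow> complex ^ 'n \<Rightarrow> complex" and F where g: "\<And>n. continuous_on UNIV (g n)"
    and F: "F\<^sub>0 \<subseteq> F" "F \<subseteq> sphere 0 1" "sphere 0 1 - F \<in> null_sets sphere_measure"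
    and lim: "\<And>p. p \<in> F \<Longrightarrow> (\<lambda>n. g n p) \<longlonglongrightarrow> \<psi> p"
    by (rule continuous_approximation_on_sphere[OF assms]) blast
  have "continuous_on (sphere 0 1) (g n)" for n by (rule continuous_on_subset[OF g]) simp
  then show ?thesis
  proof (rule holomorphic_with_boundary_limits[of g])
    fix f assume f: "holomorphic_on_cn f (ball 0 1)"
      "\<And>p l. norm p = 1 \<Longrightarrow> (\<lambda>k. g k p) \<longlonglongrightarrow> l \<Longrightarrow>
        \<exists>A. A \<subseteq> ball 0 1 \<and> A \<in> sets lebesgue \<and> (f \<longlongrightarrow> l) (at p within A) \<and>
         ((\<lambda>r. measure lebesgue (ball p r \<inter> A) / measure lebesgue (ball p r \<inter> ball 0 1)) \<longlongrightarrow> 1) (at_right 0)"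
    have "norm p = 1" if "p \<in> F" for p using F(2) that by auto
    then show ?thesis
      by (intro exI[of _ f] exI[of _ F] conjI ballI f F lim)
  qed
qed

end
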